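(* Let $(U,\Sigma,\mu)$ be a $\sigma$-finite measure space with a full ordered core $\mathcal A$. There is a unique map $f\mapsto f^o$ from $L(\Sigma)$ to $L^\downarrow(\mathcal A)$ (unique up to equality $\mu$-a.e.) such that $f^o$ is a level function of $f$ and if $0\le f_n\uparrow f$ $\mu$-a.e., then $f_n^o\uparrow f^o$ $\mu$-a.e.
   Context: $L(\Sigma)$ is the set of $\Sigma$-measurable functions $U\to[-\infty,\infty]$. An ordered core of $(U,\Sigma,\mu)$ is a subset $\mathcal A\subseteq\Sigma$, totally ordered by inclusion, containing $\emptyset$, whose members all have finite $\mu$-measure. It is $\sigma$-bounded if $\bigcup\mathcal A=\bigcup\mathcal A_0$ for some countable $\mathcal A_0\subseteq\mathcal A$, and full if it is $\sigma$-bounded and $\bigcup\mathcal A=U$. $\sigma(\mathcal A)$ is the $\sigma$-ring generated by $\mathcal A$ (a $\sigma$-algebra on $U$ when $\mathcal A$ is full). Write $u\le_{\mathcal A}v$ if for all $A\in\mathcal A$, $v\in A$ implies $u\in A$. $L^\downarrow(\mathcal A)$ is the set of core decreasing functions: $\sigma(\mathcal A)$-measurable $f:U\to[0,\infty]$ with $f(u)\ge f(v)$ whenever $u\le_{\mathcal A}v$. A function $f^o\in L^\downarrow(\mathcal A)$ is a level function of $f\in L(\Sigma)$ if for all $g\in L^\downarrow(\mathcal A)$, $$\int_Uf^og\,d\mu=\sup\Big\{\int_U|f|h\,d\mu:h\in L^\downarrow(\mathcal A),\ \int_Ah\,d\mu\le\int_Ag\,d\mu\text{ for all }A\in\mathcal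 A\Big\}.$$ The notation $0\le f_n\uparrow f$ means that $(f_n)$ is a nondecreasing sequence of nonnegative functions with pointwise limit $f$.
   Formalization: Uniqueness is stated without restriction for f that are nonnegative a.e.; for other f in L(Σ) it is stated among maps whose level function of f equals that of |f| a.e., since uniqueness over all maps fails there (for example f = 0 on {0} and −∞ on {1}). *)

theory Defs
  imports "HOL-Analysis.Analysis"
begin

definition ordered_core :: "'a measure \<Rightarrow> 'a set set \<Rightarrow> bool" where
  "ordered_core M \<A> \<longleftrightarrow>
     \<A> \<subseteq> sets M \<and> {} \<in> \<A> \<and>
     (\<forall>A\<in>\<A>. \<forall>B\<in>\<A>. A \<subseteq> B \<or> B \<subseteq> A) \<and>
     (\<forall>A\<in>\<A>. emeasure M A < \<infinity>)"

definition sigma_bounded :: "'a set set \<Rightarrow> bool" where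
  "sigma_bounded \<A> \<longleftrightarrow> (\<exists>\<A>\<^sub>0. countable \<A>\<^sub>0 \<and> \<A>\<^sub>0 \<subseteq> \<A> \<and> \<Union>\<A> = \<Union>\<A>\<^sub>0)"

definition full_ordered_core :: "'a measure \<Rightarrow> 'a set set \<Rightarrow> bool" where
  "full_ordered_core M \<A> \<longleftrightarrow> ordered_core M \<A> \<and> sigma_bounded \<A> \<and> \<Union>\<A> = space M"

inductive_set sigma_ring_sets :: "'a set set \<Rightarrow> 'a set set" for \<A> :: "'a set set" where
  Empty: "{} \<in> sigma_ring_sets \<A>"
| Basic: "A \<in> \<A> \<Longrightarrow> A \<in> sigma_ring_sets \<A>"
| Diff: "A \<in> sigma_ring_sets \<A> \<Longrightarrow> B \<in> sigma_ring_sets \<A> \<Longrightarrow> A - B \<in> sigma_ring_sets \<A>"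
| Union: "(\<And>i::nat. A i \<in> sigma_ring_sets \<A>) \<Longrightarrow> (\<Union>i. A i) \<in> sigma_ring_sets \<A>"

lemma sigma_ring_sets_full:
  assumes "full_ordered_core M \<A>"
  shows "sigma_ring_sets \<A> = sigma_sets (space M) \<A>"
proof
  have meas: "\<A> \<subseteq> sets M" and ne: "{} \<in> \<A>"
    using assms unfolding full_ordered_core_def ordered_core_def by simp_all
  from meas sets.space_closed have sub: "\<A> \<subseteq> Pow (space M)"
    by (rule order_trans)
  interpret S: sigma_algebra "space M" "sigma_sets (space M) \<A>"
    by (rule sigma_algebra_sigma_sets[OF sub])
  show "sigma_ring_sets \<A> \<subseteq> sigma_sets (space M) \<A>"
  proof
    fix A assume "A \<in> sigma_ring_sets \<A>"
    then show "A \<in> sigma_sets (space M) \<A>"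
    proof (induction rule: sigma_ring_sets.induct)
      case Empty show ?case by (rule sigma_sets.Empty)
    next
      case (Basic A) then show ?case by (rule sigma_sets.Basic)
    next
      case (Diff A B) then show ?case by (intro S.Diff)
    next
      case (Union A) then show ?case by (intro sigma_sets.Union)
    qed
  qed
  obtain \<A>\<^sub>0 where A0: "countable \<A>\<^sub>0" "\<A>\<^sub>0 \<subseteq> \<A>" "\<Union>\<A>\<^sub>0 = space M"
    using assms unfolding full_ordered_core_def sigma_bounded_def by metis
  have "(\<Union>i. from_nat_into (insert {} \<A>\<^sub>0) i) \<in> sigma_ring_sets \<A>"
  proof (intro sigma_ring_sets.Union sigma_ring_sets.Basic)
    fix i
    have "from_nat_into (insert {} \<A>\<^sub>0) i \<in> insert {} \<A>\<^sub>0"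
      by (rule from_nat_into) simp
    then show "from_nat_into (insert {} \<A>\<^sub>0) i \<in> \<A>"
      using A0(2) ne by auto
  qed
  moreover have "(\<Union>i. from_nat_into (insert {} \<A>\<^sub>0) i) = space M"
    using A0 range_from_nat_into[of "insert {} \<A>\<^sub>0"] by simp
  ultimately have top: "space M \<in> sigma_ring_sets \<A>" by simp
  show "sigma_sets (space M) \<A> \<subseteq> sigma_ring_sets \<A>"
  proof
    fix A assume "A \<in> sigma_sets (space M) \<A>"
    then show "A \<in> sigma_ring_sets \<A>"
    proof (induction rule: sigma_sets.induct)
      case (Basic A) then show ?case by (rule sigma_ring_sets.Basic)
    next
      case Empty show ?case by (rule sigma_ring_sets.Empty)
    next
      case (Compl A) with top show ?case by (intro sigma_ring_sets.Diff)
    next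
      case (Union A) then show ?case by (intro sigma_ring_sets.Union)
    qed
  qed
qed

definition core_le :: "'a set set \<Rightarrow> 'a \<Rightarrow> 'a \<Rightarrow> bool" where
  "core_le \<A> u v \<longleftrightarrow> (\<forall>A\<in>\<A>. v \<in> A \<longrightarrow> u \<in> A)"

definition core_decreasing :: "'a measure \<Rightarrow> 'a set set \<Rightarrow> ('a \<Rightarrow> ennreal) set" where
  "core_decreasing M \<A> =
     {f. (\<forall>B\<in>sets borel. f -` B \<inter> space M \<in> sigma_ring_sets \<A>) \<and>
         (\<forall>u\<in>space M. \<forall>v\<in>space M. core_le \<A> u v \<longrightarrow> f v \<le> f u)}"

lemma core_decreasing_full:
  assumes "full_ordered_core M \<A>"
  shows "core_decreasing M \<A> =
     {f \<in> borel_measurable (sigma (space M) \<A>).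
        \<forall>u\<in>space M. \<forall>v\<in>space M. core_le \<A> u v \<longrightarrow> f v \<le> f u}"
proof -
  have "\<A> \<subseteq> sets M"
    using assms unfolding full_ordered_core_def ordered_core_def by simp
  then have "\<A> \<subseteq> Pow (space M)"
    using sets.space_closed by (rule order_trans)
  then show ?thesis
    by (simp add: core_decreasing_def measurable_def sigma_ring_sets_full[OF assms])
qed

definition level_function ::
  "'a measure \<Rightarrow> 'a set set \<Rightarrow> ('a \<Rightarrow> ereal) \<Rightarrow> ('a \<Rightarrow> ennreal) \<Rightarrow> bool" where
  "level_function M \<A> f k \<longleftrightarrow>
     k \<in> core_decreasing M \<A> \<and>
     (\<forall>g\<in>core_decreasing M \<A>.
        (\<integral>\<^sup>+u. k u * g u \<partial>M) =
        Sup {(\<integral>\<^sup>+u. e2ennreal \<bar>f u\<bar> * h u \<partial>M) | h.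
               h \<in> core_decreasing M \<A> \<and>
               (\<forall>A\<in>\<A>. (\<integral>\<^sup>+u\<in>A. h u \<partial>M) \<le> (\<integral>\<^sup>+u\<in>A. g u \<partial>M))})"

definition monotone_level_map ::
  "'a measure \<Rightarrow> 'a set set \<Rightarrow> (('a \<Rightarrow> ereal) \<Rightarrow> 'a \<Rightarrow> ennreal) \<Rightarrow> bool" where
  "monotone_level_map M \<A> L \<longleftrightarrow>
     L \<in> borel_measurable M \<rightarrow> core_decreasing M \<A> \<and>
     (\<forall>f\<in>borel_measurable M. level_function M \<A> f (L f)) \<and>
     (\<forall>fs f. (\<forall>n. fs n \<in> borel_measurable M) \<longrightarrow> f \<in> borel_measurable M \<longrightarrow>
        (AE u in M. (\<forall>n. 0 \<le> fs n u) \<and> incseq (\<lambda>n. fs n u) \<and> (\<lambda>n. fs n u) \<longlonglongrightarrow> f u) \<longrightarrow>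
        (AE u in M. incseq (\<lambda>n. L (fs n) u) \<and> (\<lambda>n. L (fs n) u) \<longlonglongrightarrow> L f u))"

text \<open>
  The defining identity of a level function sees only the absolute value of \<open>f\<close>, and a level
  function need not be unique when its integrals over the core are infinite. The monotonicity
  condition, which resolves this, says nothing about functions that are not nonnegative almost
  everywhere. The values of the map on those are pinned down by the convention that the level
  function of \<open>f\<close> is that of its absolute value.
  Example: for counting measure on \<open>{0, 1}\<close> and the core \<open>{}, {0}, {0, 1}\<close>, let \<open>f 0 = 0\<close> and
  \<open>f 1 = -\<infinity>\<close>. Every \<open>k\<close> with \<open>k 0 = \<infinity>\<close> is a level function of \<open>f\<close>, whatever \<open>k 1\<close> is.
\<close>
definition abs_invariant ::
  "'a measure \<Rightarrow> (('a \<Rightarrow> ereal) \<Rightarrow> 'a \<Rightarrow> ennreal) \<Rightarrow> bool" where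
  "abs_invariant M L \<longleftrightarrow>
     (\<forall>f\<in>borel_measurable M. AE u in M. L f u = L (\<lambda>v. \<bar>f v\<bar>) u)"

end

theory Submission
  imports Defs
begin

text \<open>
  Write \<open>\<integral>\<^sub>B f\<close> for the integral of \<open>f\<close> over \<open>B\<close>. On an interval with its initial segments as core, the
  level function of \<open>f\<close> is the slope of the least concave majorant of the primitive of \<open>f\<close>. The core here
  need not come from an interval, so the construction uses the superlevel sets of that slope instead.
  They can be described without primitives: the superlevel set at \<open>t\<close> maximizes \<open>\<integral>\<^sub>B f - t \<mu>(B)\<close> among
  the down-sets \<open>B\<close>, the measurable sets that are closed downwards in the order of the core.
  Down-sets form a chain that is closed under countable unions and intersections, which yields
  maximizers (\<open>optimal_exists\<close>).

  Let \<open>f\<close> be bounded and vanish off a member \<open>X\<close> of the core, let \<open>B t\<close> be nested maximizers for rational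
  \<open>t > 0\<close>, and let \<open>k\<close> be the function with these superlevel sets. Maximality says that on a difference
  \<open>B s - B t\<close> with \<open>s < t\<close>, where \<open>k\<close> lies between \<open>s\<close> and \<open>t\<close>, the mean of \<open>f\<close> lies there as well, and that
  the mean of \<open>f\<close> over the intersection with a down-set is still at most \<open>t\<close>. Cutting \<open>X\<close> into thin layers
  of this kind gives \<open>\<integral>\<^sub>H f \<le> \<integral>\<^sub>H k\<close> for all down-sets \<open>H\<close> (\<open>envelope_majorizes\<close>). If \<open>h\<close> competes in the
  supremum for \<open>g\<close>, two applications of the layer cake formula turn this and the constraint on \<open>h\<close> into
  \<open>\<integral> f h \<le> \<integral> k h \<le> \<integral> k g\<close>. Replacing \<open>g\<close> by its mean over each layer gives a competitor that nearly
  attains \<open>\<integral> k g\<close> (\<open>envelope_nearly_attained\<close>). So \<open>k\<close> is a level function of \<open>f\<close>.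

  Comparing maximizers for different thresholds shows that \<open>k\<close> increases with \<open>f\<close> (\<open>envelope_mono\<close>). It is
  integrable, and an integrable level function is unique: its integrals over all down-sets are
  prescribed, and they determine a core decreasing function (\<open>tame_level_function_unique\<close>).

  In general, let the level map send \<open>f\<close> to the supremum of the level functions of the truncations of
  \<open>\<bar>f\<bar>\<close> in height and to members of the core that exhaust the space. The level identity passes to the limit by monotone convergence. For \<open>0 \<le> f\<^sub>n \<up> f\<close>, the level
  functions of the truncations of \<open>f\<^sub>n\<close> at a fixed stage increase to a level function of the truncation
  of \<open>f\<close>, which is unique, and interchanging suprema gives \<open>f\<^sub>n\<^sup>o \<up> f\<^sup>o\<close>. Conversely, every map with
  this monotonicity is determined on nonnegative functions by its values on truncations, where level
  functions are unique.
\<close>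

section \<open>Integrals of nonnegative functions\<close>

lemma ennreal_add_le_cancel_left:
  fixes a b c :: ennreal
  shows "a + b \<le> a + c \<Longrightarrow> a < \<infinity> \<Longrightarrow> b \<le> c"
  by (auto simp: ennreal_add_left_cancel_le)

lemma nn_integral_split:
  assumes "f \<in> borel_measurable M" "B \<in> sets M" "C \<in> sets M" "B \<inter> C = {}"
  shows "(\<integral>\<^sup>+u\<in>B \<union> C. f u \<partial>M) = (\<integral>\<^sup>+u\<in>B. f u \<partial>M) + (\<integral>\<^sup>+u\<in>C. f u \<partial>M)"
  using assms by (intro nn_integral_disjoint_pair) auto

lemma indicator_mult_nn_integral:
  "(\<integral>\<^sup>+u\<in>D. \<phi> u * indicator H u \<partial>M) = (\<integral>\<^sup>+u\<in>D \<inter> H. \<phi> u \<partial>M)"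
  for \<phi> :: "'a \<Rightarrow> ennreal"
  by (intro nn_integral_cong) (auto split: split_indicator)

lemma nn_integral_subset_finite:
  assumes "(\<integral>\<^sup>+u\<in>X. f u \<partial>M) < \<infinity>" "B \<subseteq> X"
  shows "(\<integral>\<^sup>+u\<in>B. f u \<partial>M) < \<infinity>"
  using assms(2)
  by (intro le_less_trans[OF _ assms(1)] nn_integral_mono) (auto split: split_indicator)

lemma nn_integral_piecewise_le:
  assumes [measurable]: "\<phi> \<in> borel_measurable M" "\<psi> \<in> borel_measurable M"
    and D: "\<And>j::nat. D j \<in> sets M" "disjoint_family D"
    and le: "\<And>j. (\<integral>\<^sup>+u\<in>D j. \<phi> u \<partial>M) \<le> (\<integral>\<^sup>+u\<in>D j. \<psi> u \<partial>M)"
  shows "(\<integral>\<^sup>+u\<in>(\<Union>j. D j). \<phi> u \<partial>M) \<le> (\<integral>\<^sup>+u\<in>(\<Union>j. D j). \<psi> u \<partial>M)"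
proof -
  have "(\<integral>\<^sup>+u\<in>(\<Union>j. D j). \<rho> u \<partial>M) = (\<Sum>j. (\<integral>\<^sup>+u\<in>D j. \<rho> u \<partial>M))"
    if [measurable]: "\<rho> \<in> borel_measurable M" for \<rho> :: "'a \<Rightarrow> ennreal"
    using suminf_emeasure[of D "density M \<rho>"] D by (simp add: emeasure_density image_subset_iff)
  then show ?thesis using le by (auto intro!: suminf_le)
qed

lemma nn_integral_mult_SUP_AE:
  fixes f :: "nat \<Rightarrow> 'a \<Rightarrow> ennreal"
  assumes [measurable]: "\<And>n. f n \<in> borel_measurable M" "h \<in> borel_measurable M"
    and mono: "\<And>n. AE u in M. f n u \<le> f (Suc n) u" and SUP: "AE u in M. F u = (SUP n. f n u)"
  shows "(\<integral>\<^sup>+u. F u * h u \<partial>M) = (SUP n. (\<integral>\<^sup>+u. f n u * h u \<partial>M))"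
proof -
  have "(\<integral>\<^sup>+u. F u * h u \<partial>M) = (\<integral>\<^sup>+u. (SUP n. f n u * h u) \<partial>M)"
    using SUP by (intro nn_integral_cong_AE) (auto simp: SUP_mult_right_ennreal)
  also have "\<dots> = (SUP n. (\<integral>\<^sup>+u. f n u * h u \<partial>M))"
  proof (rule nn_integral_monotone_convergence_SUP_AE)
    show "AE u in M. f n u * h u \<le> f (Suc n) u * h u" for n
      using mono[of n] by eventually_elim (simp add: mult_right_mono)
  qed measurable
  finally show ?thesis .
qed

lemma emeasure_lborel_subgraph:
  "emeasure lborel {t. 0 \<le> t \<and> ennreal t < x} = x"
proof (cases x)
  case (real r)
  then have "{t. 0 \<le> t \<and> ennreal t < x} = {0..<r}"
    by (auto simp: ennreal_less_iff)
  with real show ?thesis by simp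
next
  case top
  then have "{t. 0 \<le> t \<and> ennreal t < x} = {0..}" by (auto simp: less_top[symmetric])
  moreover have "emeasure lborel {0::real..} = \<infinity>"
  proof (rule ccontr)
    assume "emeasure lborel {0::real..} \<noteq> \<infinity>"
    then obtain n where n: "emeasure lborel {0::real..} < of_nat n"
      using ennreal_Ex_less_of_nat by (auto simp: less_top)
    have "of_nat n = emeasure lborel {0..real n}"
      by (simp add: ennreal_of_nat_eq_real_of_nat)
    also have "\<dots> \<le> emeasure lborel {0::real..}"
      by (intro emeasure_mono) auto
    finally show False using n by simp
  qed
  ultimately show ?thesis using top by simp
qed

text \<open>
  Integrals against a core decreasing factor thereby reduce to integrals over its superlevel sets.
  The measure with density \<open>\<phi>\<close> fails to be \<open>\<sigma>\<close>-finite if \<open>\<phi>\<close> is infinite on a nonnull set, so Tonelli is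
  applied to \<open>M\<close> with \<open>\<phi>\<close> as part of the integrand.
\<close>

lemma (in sigma_finite_measure) nn_integral_layer_cake:
  assumes [measurable]: "\<phi> \<in> borel_measurable M" "k \<in> borel_measurable M"
  shows "(\<integral>\<^sup>+u. \<phi> u * k u \<partial>M) =
    (\<integral>\<^sup>+t. (\<integral>\<^sup>+u\<in>{u \<in> space M. ennreal t < k u}. \<phi> u \<partial>M) * indicator {0..} t \<partial>lborel)"
proof -
  interpret P: pair_sigma_finite M lborel ..
  have "(\<integral>\<^sup>+t. (\<integral>\<^sup>+u\<in>{u \<in> space M. ennreal t < k u}. \<phi> u \<partial>M) * indicator {0..} t \<partial>lborel)
      = (\<integral>\<^sup>+t. (\<integral>\<^sup>+u. (if 0 \<le> t \<and> ennreal t < k u then \<phi> u else 0) \<partial>M) \<partial>lborel)"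
    by (intro nn_integral_cong)
       (auto simp: nn_integral_multc[symmetric] intro!: nn_integral_cong split: split_indicator)
  also have "\<dots> = (\<integral>\<^sup>+u. (\<integral>\<^sup>+t. (if 0 \<le> t \<and> ennreal t < k u then \<phi> u else 0) \<partial>lborel) \<partial>M)"
    by (rule P.Fubini') measurable
  also have "\<dots> = (\<integral>\<^sup>+u. (\<integral>\<^sup>+t. \<phi> u * indicator {t. 0 \<le> t \<and> ennreal t < k u} t \<partial>lborel) \<partial>M)"
    by (intro nn_integral_cong) (auto split: split_indicator)
  also have "\<dots> = (\<integral>\<^sup>+u. \<phi> u * k u \<partial>M)"
    by (intro nn_integral_cong, subst nn_integral_cmult_indicator)
       (auto simp: emeasure_lborel_subgraph)
  finally show ?thesis by simp
qed

definition pos_rats :: "real set" where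
  "pos_rats = {t. t \<in> \<rat> \<and> 0 < t}"

lemma countable_pos_rats: "countable pos_rats"
  unfolding pos_rats_def by (rule countable_subset[OF _ countable_rat]) auto

lemma pos_rats_dense:
  fixes x y :: ennreal
  assumes "x < y"
  obtains r where "r \<in> pos_rats" "x < ennreal r" "ennreal r < y"
proof -
  obtain q where q: "x < ennreal (real_of_rat q)" "ennreal (real_of_rat q) < y"
    using ennreal_rat_dense[OF assms] by blast
  then have "0 < real_of_rat q" by (metis ennreal_neg not_le not_less_zero)
  with q show ?thesis by (intro that[of "real_of_rat q"]) (simp_all add: pos_rats_def)
qed

text \<open>
  The finiteness of the factor \<open>c\<close> makes the error term small; error terms below have this shape
  with \<open>c\<close> a measure or an integral.
\<close>

lemma ennreal_le_rat_epsilon: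
  fixes x y c :: ennreal
  assumes "c < \<infinity>" and le: "\<And>\<delta>. \<delta> \<in> pos_rats \<Longrightarrow> x \<le> y + ennreal \<delta> * c"
  shows "x \<le> y"
proof (rule ennreal_le_epsilon)
  fix e :: real assume e: "0 < e"
  obtain r where r: "c = ennreal r" "0 \<le> r" using assms(1) by (cases c) auto
  have "0 < e / (r + 1)" using e r by simp
  then obtain q where q: "q \<in> \<rat>" "0 < q" "q < e / (r + 1)" using Rats_dense_in_real by blast
  then have "q * r \<le> q * (r + 1)" "q * (r + 1) < e" using r by (auto simp: pos_less_divide_eq)
  then have "q * r \<le> e" by linarith
  have "x \<le> y + ennreal q * c" using q by (intro le) (simp add: pos_rats_def)
  also have "\<dots> = y + ennreal (q * r)" using q r by (simp add: ennreal_mult)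
  also have "\<dots> \<le> y + ennreal e" using \<open>q * r \<le> e\<close> by (intro add_left_mono ennreal_leI)
  finally show "x \<le> y + ennreal e" .
qed

text \<open>
  The average of \<open>g\<close> over \<open>D\<close>. On null sets it is the infimum, so that for every nonempty \<open>D\<close> of finite
  measure it lies between the bounds of \<open>g\<close> on \<open>D\<close>.
\<close>

definition mean :: "'a measure \<Rightarrow> ('a \<Rightarrow> ennreal) \<Rightarrow> 'a set \<Rightarrow> ennreal" where
  "mean M g D = (if emeasure M D = 0 then INF u\<in>D. g u else (\<integral>\<^sup>+u\<in>D. g u \<partial>M) / emeasure M D)"

lemma mean_mult:
  assumes D: "D \<in> sets M" "emeasure M D < \<infinity>"
  shows "mean M g D * emeasure M D = (\<integral>\<^sup>+u\<in>D. g u \<partial>M)"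
proof (cases "emeasure M D = 0")
  case True
  then have "(\<integral>\<^sup>+u\<in>D. g u \<partial>M) = 0" using D by (intro nn_integral_null_set) auto
  with True show ?thesis by simp
next
  case False
  then show ?thesis using D by (simp add: mean_def ennreal_divide_times ennreal_mult_divide_eq)
qed

lemma mean_ge:
  assumes D: "D \<in> sets M" "emeasure M D < \<infinity>" and c: "\<And>u. u \<in> D \<Longrightarrow> c \<le> g u"
  shows "c \<le> mean M g D"
proof (cases "emeasure M D = 0")
  case True
  then show ?thesis using c by (auto simp: mean_def intro: INF_greatest)
next
  case False
  have "c * emeasure M D = (\<integral>\<^sup>+u. c * indicator D u \<partial>M)"
    using D(1) by (simp add: nn_integral_cmult_indicator)
  also have "\<dots> \<le> (\<integral>\<^sup>+u\<in>D. g u \<partial>M)"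
    using c by (intro nn_integral_mono) (auto split: split_indicator)
  finally have "c * emeasure M D / emeasure M D \<le> mean M g D"
    using False by (simp add: mean_def divide_right_mono_ennreal)
  then show ?thesis using False D(2) by (simp add: ennreal_mult_divide_eq)
qed

lemma mean_le:
  assumes D: "D \<in> sets M" "emeasure M D < \<infinity>" "D \<noteq> {}" and c: "\<And>u. u \<in> D \<Longrightarrow> g u \<le> c"
  shows "mean M g D \<le> c"
proof (cases "emeasure M D = 0")
  case True
  then show ?thesis using c D(3) by (auto simp: mean_def intro: INF_lower2)
next
  case False
  have "(\<integral>\<^sup>+u\<in>D. g u \<partial>M) \<le> (\<integral>\<^sup>+u. c * indicator D u \<partial>M)"
    using c by (intro nn_integral_mono) (auto split: split_indicator)
  also have "\<dots> = c * emeasure M D"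
    using D(1) by (simp add: nn_integral_cmult_indicator)
  finally have "mean M g D \<le> c * emeasure M D / emeasure M D"
    using False by (simp add: mean_def divide_right_mono_ennreal)
  then show ?thesis using False D(2) by (simp add: ennreal_mult_divide_eq)
qed

section \<open>Down-sets of an ordered core\<close>

locale full_core = sigma_finite_measure M for M :: "'a measure" +
  fixes \<A> :: "'a set set"
  assumes full: "full_ordered_core M \<A>"
begin

lemma core_subset: "\<A> \<subseteq> sets M"
  and core_empty: "{} \<in> \<A>"
  and core_chain: "A \<in> \<A> \<Longrightarrow> B \<in> \<A> \<Longrightarrow> A \<subseteq> B \<or> B \<subseteq> A"
  and core_finite: "A \<in> \<A> \<Longrightarrow> emeasure M A < \<infinity>"
  using full unfolding full_ordered_core_def ordered_core_def by auto

lemma core_Pow: "\<A> \<subseteq> Pow (space M)"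
  using core_subset sets.space_closed by (rule order_trans)

lemma core_sets: "A \<in> \<A> \<Longrightarrow> A \<in> sets M"
  using core_subset by blast

lemma core_finite_Un: "range S \<subseteq> \<A> \<Longrightarrow> (\<Union>i\<le>n::nat. S i) \<in> \<A>"
proof (induction n)
  case (Suc n)
  then have "S (Suc n) \<in> \<A>" by auto
  with core_chain[OF Suc.IH[OF Suc.prems] this] Suc show ?case
    by (auto simp: atMost_Suc sup.absorb1 sup.absorb2)
qed auto

lemma core_finite_Int: "range S \<subseteq> \<A> \<Longrightarrow> (\<Inter>i\<le>n::nat. S i) \<in> \<A>"
proof (induction n)
  case (Suc n)
  then have "S (Suc n) \<in> \<A>" by auto
  with core_chain[OF Suc.IH[OF Suc.prems] this] Suc show ?case
    by (auto simp: atMost_Suc inf.absorb1 inf.absorb2)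
qed auto

lemma core_exhaustion:
  obtains X :: "nat \<Rightarrow> 'a set" where "range X \<subseteq> \<A>" "incseq X" "(\<Union>n. X n) = space M"
proof -
  obtain \<A>\<^sub>0 where A0: "countable \<A>\<^sub>0" "\<A>\<^sub>0 \<subseteq> \<A>" "\<Union>\<A>\<^sub>0 = space M"
    using full unfolding full_ordered_core_def sigma_bounded_def by metis
  define Y where "Y = from_nat_into (insert {} \<A>\<^sub>0)"
  have rY: "range Y = insert {} \<A>\<^sub>0"
    using A0(1) unfolding Y_def by (intro range_from_nat_into) auto
  then have Y: "Y n \<in> \<A>" for n
    using A0(2) core_empty by (metis insertE rangeI subsetD)
  define X where "X n = (\<Union>i\<le>n. Y i)" for n
  have "X n \<in> \<A>" for n
    unfolding X_def using Y by (intro core_finite_Un) auto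
  moreover have "incseq X"
    unfolding incseq_def X_def by (auto intro: order_trans)
  moreover have "(\<Union>n. X n) = space M"
  proof -
    have "(\<Union>n. X n) = (\<Union>n. Y n)" unfolding X_def by auto
    then show ?thesis using rY A0(3) by simp
  qed
  ultimately show ?thesis using that by blast
qed

text \<open>
  The sets whose indicators are core decreasing. All superlevel sets of core decreasing functions are
  of this kind.
\<close>

definition down_sets :: "'a set set" where
  "down_sets = {B \<in> sigma_sets (space M) \<A>.
     \<forall>u\<in>space M. \<forall>v\<in>B. core_le \<A> u v \<longrightarrow> u \<in> B}"

lemma down_sets_space: "B \<in> down_sets \<Longrightarrow> B \<subseteq> space M"
  unfolding down_sets_def using sigma_sets_into_sp[OF core_Pow] by blast

lemma down_sets_sets: "B \<in> down_sets \<Longrightarrow> B \<in> sets M"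
  unfolding down_sets_def using sets.sigma_sets_subset[OF core_subset] by blast

lemma core_down_sets: "A \<in> \<A> \<Longrightarrow> A \<in> down_sets"
  unfolding down_sets_def core_le_def by auto

lemma space_down_sets: "space M \<in> down_sets"
  and empty_down_sets: "{} \<in> down_sets"
  unfolding down_sets_def using sigma_sets_top by (auto intro: sigma_sets.Empty)

lemma core_le_total: "core_le \<A> u v \<or> core_le \<A> v u"
  unfolding core_le_def using core_chain by blast

lemma core_le_separated:
  "B \<in> down_sets \<Longrightarrow> u \<in> B \<Longrightarrow> v \<in> space M - B \<Longrightarrow> core_le \<A> u v"
  using core_le_total[of u v] unfolding down_sets_def by blast

text \<open>
  The core order is total, so of two points \<open>u \<in> B - C\<close> and \<open>v \<in> C - B\<close> one would precede the other and
  lie in both sets.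
\<close>

lemma down_sets_chain:
  assumes "B \<in> down_sets" "C \<in> down_sets"
  shows "B \<subseteq> C \<or> C \<subseteq> B"
  using assms core_le_separated down_sets_space unfolding down_sets_def by blast

lemma down_sets_Un: "B \<in> down_sets \<Longrightarrow> C \<in> down_sets \<Longrightarrow> B \<union> C \<in> down_sets"
  and down_sets_Int: "B \<in> down_sets \<Longrightarrow> C \<in> down_sets \<Longrightarrow> B \<inter> C \<in> down_sets"
  by (metis down_sets_chain sup.absorb1 sup.absorb2, metis down_sets_chain inf.absorb1 inf.absorb2)

lemma down_sets_UN:
  assumes "countable I" "\<And>i. i \<in> I \<Longrightarrow> B i \<in> down_sets"
  shows "(\<Union>i\<in>I. B i) \<in> down_sets"
proof -
  have "(\<Union>i\<in>I. B i) \<in> sigma_sets (space M) \<A>"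
    using assms by (intro sigma_sets_UNION) (auto simp: down_sets_def)
  with assms(2) show ?thesis unfolding down_sets_def by blast
qed

lemma down_sets_INT:
  fixes B :: "nat \<Rightarrow> 'a set"
  assumes "\<And>i. B i \<in> down_sets"
  shows "(\<Inter>i. B i) \<in> down_sets"
proof -
  have "(\<Inter>i. B i) \<in> sigma_sets (space M) \<A>"
    using assms core_Pow by (intro sigma_sets_Inter) (auto simp: down_sets_def)
  with assms show ?thesis unfolding down_sets_def by blast
qed

text \<open>
  Membership in \<open>B\<close> is decided by countably many members of the core, a property that passes through
  all steps that generate the \<open>\<sigma>\<close>-algebra. Those members which lie inside \<open>B\<close> and those which contain it
  leave a gap that they cannot split. So \<open>B\<close> contains none or all of the gap: it is a union of the
  former or an intersection of the latter.
\<close>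

lemma down_sets_cases:
  assumes "B \<in> down_sets"
  obtains S :: "nat \<Rightarrow> 'a set" where "range S \<subseteq> \<A>" "B = (\<Union>n. S n)"
  | S :: "nat \<Rightarrow> 'a set" where "range S \<subseteq> \<A>" "B = (\<Inter>n. S n)"
proof -
  have "\<exists>\<A>\<^sub>1. countable \<A>\<^sub>1 \<and> \<A>\<^sub>1 \<subseteq> \<A> \<and>
      (\<forall>u\<in>space M. \<forall>v\<in>space M. (\<forall>A\<in>\<A>\<^sub>1. u \<in> A \<longleftrightarrow> v \<in> A) \<longrightarrow> (u \<in> B \<longleftrightarrow> v \<in> B))"
    if "B \<in> sigma_sets (space M) \<A>" for B
    using that
  proof induction
    case (Basic A) then show ?case by (intro exI[of _ "{A}"]) auto
  next
    case Empty show ?case by (intro exI[of _ "{}"]) auto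
  next
    case (Compl A) then show ?case by (metis Diff_iff)
  next
    case (Union A)
    then obtain F where F: "\<And>i::nat. countable (F i)" "\<And>i. F i \<subseteq> \<A>"
      "\<And>i u v. u \<in> space M \<Longrightarrow> v \<in> space M \<Longrightarrow> (\<forall>A\<in>F i. u \<in> A \<longleftrightarrow> v \<in> A) \<Longrightarrow>
         u \<in> A i \<longleftrightarrow> v \<in> A i"
      by metis
    show ?case
    proof (intro exI[of _ "\<Union>i. F i"] conjI ballI impI)
      show "countable (\<Union>i. F i)" using F(1) by auto
      show "(\<Union>i. F i) \<subseteq> \<A>" using F(2) by auto
      fix u v assume uv: "u \<in> space M" "v \<in> space M" "\<forall>A\<in>\<Union>i. F i. (u \<in> A) = (v \<in> A)"
      then have "u \<in> A i \<longleftrightarrow> v \<in> A i" for i by (intro F(3)) auto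
      then show "(u \<in> (\<Union>i. A i)) = (v \<in> (\<Union>i. A i))" by auto
    qed
  qed
  from this[of B] assms have "\<exists>\<A>\<^sub>1. countable \<A>\<^sub>1 \<and> \<A>\<^sub>1 \<subseteq> \<A> \<and>
      (\<forall>u\<in>space M. \<forall>v\<in>space M. (\<forall>A\<in>\<A>\<^sub>1. u \<in> A \<longleftrightarrow> v \<in> A) \<longrightarrow> (u \<in> B \<longleftrightarrow> v \<in> B))"
    unfolding down_sets_def by blast
  then obtain \<A>\<^sub>1 where A1: "countable \<A>\<^sub>1" "\<A>\<^sub>1 \<subseteq> \<A>" and
    sat: "\<And>u v. u \<in> space M \<Longrightarrow> v \<in> space M \<Longrightarrow> (\<And>A. A \<in> \<A>\<^sub>1 \<Longrightarrow> u \<in> A \<longleftrightarrow> v \<in> A) \<Longrightarrow>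
      u \<in> B \<Longrightarrow> v \<in> B"
    by metis
  \<comment> \<open>The exhausting sequence ensures that some outer set exists; otherwise \<open>B = space M\<close> would
    have to be an empty intersection.\<close>
  obtain X :: "nat \<Rightarrow> 'a set" where X: "range X \<subseteq> \<A>" "incseq X" "(\<Union>n. X n) = space M"
    by (rule core_exhaustion)
  define inner where "inner = insert {} {A \<in> \<A>\<^sub>1 \<union> range X. A \<subseteq> B}"
  define outer where "outer = {A \<in> \<A>\<^sub>1 \<union> range X. B \<subseteq> A}"
  have c: "countable {A \<in> \<A>\<^sub>1 \<union> range X. P A}" for P
    by (rule countable_subset[of _ "\<A>\<^sub>1 \<union> range X"]) (use A1(1) in auto)
  have cnt: "countable inner" "countable outer"
    unfolding inner_def outer_def using c by (simp_all only: countable_insert)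
  have sub: "inner \<subseteq> \<A>" "outer \<subseteq> \<A>"
    unfolding inner_def outer_def using A1(2) X(1) core_empty by auto
  have dich: "A \<in> inner \<or> A \<in> outer" if "A \<in> \<A>\<^sub>1 \<union> range X" for A
    using that down_sets_chain[OF core_down_sets assms, of A] A1(2) X(1)
    unfolding inner_def outer_def by auto
  show ?thesis
  proof (cases "\<Union>inner = B")
    case True
    have "inner \<noteq> {}" unfolding inner_def by simp
    then have "range (from_nat_into inner) = inner" using cnt(1) by (rule range_from_nat_into)
    with True sub that(1)[of "from_nat_into inner"] show ?thesis by simp
  next
    case False
    then obtain u where u: "u \<in> B" "u \<notin> \<Union>inner" unfolding inner_def by blast
    have uM: "u \<in> space M" using u(1) down_sets_space[OF assms] by blast
    have ne: "outer \<noteq> {}"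
    proof -
      obtain n where "u \<in> X n" using X(3) uM by blast
      then show ?thesis using dich[of "X n"] u(2) by blast
    qed
    have "B = \<Inter>outer"
    proof
      show "B \<subseteq> \<Inter>outer" unfolding outer_def by blast
      show "\<Inter>outer \<subseteq> B"
      proof
        fix v assume v: "v \<in> \<Inter>outer"
        then have vM: "v \<in> space M" using ne sub(2) core_Pow by blast
        show "v \<in> B"
        proof (rule ccontr)
          \<comment> \<open>A point of the gap between inner and outer sets is indistinguishable from \<open>u\<close>.\<close>
          assume nv: "v \<notin> B"
          have "u \<in> A \<longleftrightarrow> v \<in> A" if "A \<in> \<A>\<^sub>1" for A
            using dich[of A] that u v nv unfolding inner_def outer_def by blast
          with sat[OF uM vM _ u(1)] nv show False by blast
        qed
      qed
    qed
    moreover have "range (from_nat_into outer) = outer" using ne cnt(2) by (rule range_from_nat_into)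
    ultimately show ?thesis using sub that(2)[of "from_nat_into outer"] by simp
  qed
qed

section \<open>Core decreasing functions\<close>

lemma core_decreasing_iff:
  "h \<in> core_decreasing M \<A> \<longleftrightarrow> h \<in> borel_measurable (sigma (space M) \<A>) \<and>
     (\<forall>u\<in>space M. \<forall>v\<in>space M. core_le \<A> u v \<longrightarrow> h v \<le> h u)"
  unfolding core_decreasing_full[OF full] by simp

lemma core_decreasing_measurable:
  assumes "h \<in> core_decreasing M \<A>"
  shows "h \<in> borel_measurable M"
proof -
  have "h \<in> borel_measurable (sigma (space M) \<A>)"
    using assms by (simp add: core_decreasing_iff)
  moreover have "sets (sigma (space M) \<A>) \<subseteq> sets M"
    using sets.sigma_sets_subset[OF core_subset] core_Pow by simp
  ultimately show ?thesis
    using measurable_mono[of borel borel "sigma (space M) \<A>" M] core_Pow by auto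
qed

lemma core_decreasing_le:
  assumes "h \<in> core_decreasing M \<A>" "B \<in> down_sets" "u \<in> B" "v \<in> space M - B"
  shows "h v \<le> h u"
  using assms core_le_separated[OF assms(2-4)] down_sets_space[OF assms(2)]
  unfolding core_decreasing_iff by blast

lemma superlevel_down_sets:
  assumes "h \<in> core_decreasing M \<A>"
  shows "{u \<in> space M. t < h u} \<in> down_sets"
proof -
  have h: "h \<in> borel_measurable (sigma (space M) \<A>)"
    and le: "\<And>u v. u \<in> space M \<Longrightarrow> v \<in> space M \<Longrightarrow> core_le \<A> u v \<Longrightarrow> h v \<le> h u"
    using assms by (auto simp: core_decreasing_iff)
  have "h -` {t<..} \<inter> space M \<in> sigma_sets (space M) \<A>"
    using measurable_sets[OF h, of "{t<..}"] core_Pow by simp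
  moreover have "h -` {t<..} \<inter> space M = {u \<in> space M. t < h u}" by auto
  ultimately show ?thesis
    unfolding down_sets_def by (simp only: mem_Collect_eq) (blast intro: less_le_trans le)
qed

lemma indicator_core_decreasing:
  assumes "B \<in> down_sets"
  shows "(\<lambda>u. c * indicator B u) \<in> core_decreasing M \<A>"
proof -
  have "B \<in> sets (sigma (space M) \<A>)"
    using assms core_Pow by (simp add: down_sets_def)
  then have "(\<lambda>u. c * indicator B u :: ennreal) \<in> borel_measurable (sigma (space M) \<A>)"
    by measurable
  with assms show ?thesis
    unfolding core_decreasing_iff down_sets_def by (auto split: split_indicator)
qed

lemma core_decreasing_min:
  assumes "h \<in> core_decreasing M \<A>"
  shows "(\<lambda>u. min (h u) c) \<in> core_decreasing M \<A>"
proof -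
  have "(\<lambda>u. min (h u) c) \<in> borel_measurable (sigma (space M) \<A>)"
    using assms unfolding core_decreasing_iff by (intro borel_measurable_min) auto
  with assms show ?thesis
    unfolding core_decreasing_iff by (meson min.mono order_refl)
qed

lemma core_decreasing_SUP:
  assumes "countable I" "\<And>i. i \<in> I \<Longrightarrow> h i \<in> core_decreasing M \<A>"
  shows "(\<lambda>u. SUP i\<in>I. h i u) \<in> core_decreasing M \<A>"
proof -
  have "(\<lambda>u. SUP i\<in>I. h i u) \<in> borel_measurable (sigma (space M) \<A>)"
    using assms unfolding core_decreasing_iff by (intro borel_measurable_SUP) auto
  moreover have "(SUP i\<in>I. h i v) \<le> (SUP i\<in>I. h i u)"
    if "u \<in> space M" "v \<in> space M" "core_le \<A> u v" for u v
    using that assms(2) unfolding core_decreasing_iff by (intro SUP_subset_mono order_refl) blast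
  ultimately show ?thesis unfolding core_decreasing_iff by blast
qed

text \<open>
  By the layer cake formula, the superlevel sets of \<open>h\<close> suffice.
\<close>

lemma core_decreasing_nn_integral_mono:
  assumes [measurable]: "\<phi> \<in> borel_measurable M" "\<psi> \<in> borel_measurable M"
    and h: "h \<in> core_decreasing M \<A>"
    and le: "\<And>B. B \<in> down_sets \<Longrightarrow> (\<integral>\<^sup>+u\<in>B. \<phi> u \<partial>M) \<le> (\<integral>\<^sup>+u\<in>B. \<psi> u \<partial>M)"
  shows "(\<integral>\<^sup>+u. \<phi> u * h u \<partial>M) \<le> (\<integral>\<^sup>+u. \<psi> u * h u \<partial>M)"
  using core_decreasing_measurable[OF h]
  by (simp only: nn_integral_layer_cake assms)
     (intro nn_integral_mono mult_right_mono le superlevel_down_sets h zero_le)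

text \<open>
  The constraint in the definition of a level function mentions only members of the core. To use it
  against superlevel sets it has to be extended to countable unions, where continuity from below
  suffices, and to countable intersections, where all integrals of \<open>g\<close> along the sequence may be
  infinite.
\<close>

lemma down_sets_nn_integral_mono:
  assumes h: "h \<in> core_decreasing M \<A>" and g: "g \<in> core_decreasing M \<A>"
    and le: "\<And>A. A \<in> \<A> \<Longrightarrow> (\<integral>\<^sup>+u\<in>A. h u \<partial>M) \<le> (\<integral>\<^sup>+u\<in>A. g u \<partial>M)"
    and B: "B \<in> down_sets"
  shows "(\<integral>\<^sup>+u\<in>B. h u \<partial>M) \<le> (\<integral>\<^sup>+u\<in>B. g u \<partial>M)"
proof -
  note [measurable] = core_decreasing_measurable[OF h] core_decreasing_measurable[OF g]
  define H where "H = density M h"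
  define G where "G = density M g"
  have sets [simp]: "sets H = sets M" "sets G = sets M" by (simp_all add: H_def G_def)
  have eq: "emeasure H E = (\<integral>\<^sup>+u\<in>E. h u \<partial>M)" "emeasure G E = (\<integral>\<^sup>+u\<in>E. g u \<partial>M)"
    if "E \<in> sets M" for E
    using that by (auto simp: H_def G_def emeasure_density)
  have HG: "emeasure H A \<le> emeasure G A" if "A \<in> \<A>" for A
    using le[OF that] core_sets[OF that] by (simp add: eq)
  have "emeasure H B \<le> emeasure G B"
    using B
  proof (cases rule: down_sets_cases)
    case (1 S)
    define T where "T n = (\<Union>i\<le>n. S i)" for n :: nat
    have T: "T n \<in> \<A>" for n using core_finite_Un[OF 1(1)] by (simp add: T_def)
    have inc: "incseq T" unfolding T_def incseq_def by (auto intro: order_trans)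
    have BT: "B = (\<Union>n. T n)" using 1(2) by (auto simp: T_def)
    have "emeasure H B = (SUP n. emeasure H (T n))"
      unfolding BT using T core_sets inc by (intro SUP_emeasure_incseq[symmetric]) auto
    also have "\<dots> \<le> (SUP n. emeasure G (T n))"
      using HG T by (intro SUP_mono') blast
    also have "\<dots> = emeasure G B"
      unfolding BT using T core_sets inc by (intro SUP_emeasure_incseq) auto
    finally show ?thesis .
  next
    case (2 S)
    define T where "T n = (\<Inter>i\<le>n. S i)" for n :: nat
    have T: "T n \<in> \<A>" for n using core_finite_Int[OF 2(1)] by (simp add: T_def)
    have dec: "decseq T" unfolding T_def decseq_def by (auto intro: order_trans)
    have BT: "B = (\<Inter>n. T n)" using 2(2) by (auto simp: T_def)
    show ?thesis
    proof (cases "\<exists>n. emeasure G (T n) \<noteq> \<infinity>")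
      case True
      then have "\<exists>n. emeasure H (T n) \<noteq> \<infinity>"
        using HG T by (metis infinity_ennreal_def neq_top_trans)
      then have "emeasure H B = (INF n. emeasure H (T n))"
        unfolding BT using T core_sets dec by (intro INF_emeasure_decseq'[symmetric]) auto
      also have "\<dots> \<le> (INF n. emeasure G (T n))"
        using HG T by (intro INF_mono') blast
      also have "\<dots> = emeasure G B"
        unfolding BT using T core_sets dec True by (intro INF_emeasure_decseq') auto
      finally show ?thesis .
    next
      case False
      \<comment> \<open>Continuity from above fails here. If \<open>g\<close> is finite at a point of \<open>B\<close>, that value bounds \<open>g\<close>
        off \<open>B\<close>, so the infinite integrals over the \<open>T n\<close> come from \<open>B\<close> itself; otherwise \<open>g\<close> is
        infinite on \<open>B\<close>.\<close>
      have Bs: "B \<in> sets M" "B \<subseteq> T 0" using down_sets_sets[OF B] BT by auto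
      show ?thesis
      proof (cases "\<exists>u\<in>B. g u < \<infinity>")
        case True
        then obtain u where u: "u \<in> B" "g u < \<infinity>" by blast
        have "emeasure G (T 0) = emeasure G B + emeasure G (T 0 - B)"
          using Bs core_sets[OF T] by (subst plus_emeasure) (auto intro!: arg_cong[where f="emeasure G"])
        also have "emeasure G (T 0 - B) \<le> (\<integral>\<^sup>+v. g u * indicator (T 0) v \<partial>M)"
          using Bs core_sets[OF T] eq(2)[of "T 0 - B"]
          by (auto intro!: nn_integral_mono core_decreasing_le[OF g B u(1)] split: split_indicator)
        also have "\<dots> = g u * emeasure M (T 0)"
          using core_sets[OF T] by (subst nn_integral_cmult_indicator) auto
        finally have "\<infinity> \<le> emeasure G B + g u * emeasure M (T 0)"
          using False by (auto simp: add_left_mono)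
        moreover have "g u * emeasure M (T 0) < \<infinity>"
          using u(2) core_finite[OF T] by (simp add: ennreal_mult_less_top)
        ultimately show ?thesis by (auto simp: top_unique)
      next
        case False
        then have top: "g u = \<infinity>" if "u \<in> B" for u using that by (auto simp: less_top[symmetric])
        show ?thesis
          unfolding eq[OF Bs(1)] using top
          by (intro nn_integral_mono) (auto split: split_indicator)
      qed
    qed
  qed
  then show ?thesis using eq[of B] down_sets_sets[OF B] by simp
qed

section \<open>Maximizing an integral minus a multiple of the measure\<close>

text \<open>
  A maximizer of \<open>\<integral>\<^sub>B f - t \<mu>(B)\<close> among the down-sets \<open>B \<subseteq> X\<close>, with the subtracted terms moved to the
  other side. In terms of primitives, it marks where the least concave majorant of the primitive of
  \<open>f\<close> has a tangent of slope \<open>t\<close>.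
\<close>

definition optimal :: "'a set \<Rightarrow> ('a \<Rightarrow> ennreal) \<Rightarrow> real \<Rightarrow> 'a set \<Rightarrow> bool" where
  "optimal X f t B \<longleftrightarrow> B \<in> down_sets \<and> B \<subseteq> X \<and>
     (\<forall>H\<in>down_sets. H \<subseteq> X \<longrightarrow>
        (\<integral>\<^sup>+u\<in>H. f u \<partial>M) + ennreal t * emeasure M B
        \<le> (\<integral>\<^sup>+u\<in>B. f u \<partial>M) + ennreal t * emeasure M H)"

text \<open>
  The functional is continuous for monotone limits. In a chain, the upper limit of a maximizing
  sequence is reached by two such limits that do not lower the bounds.
\<close>

lemma optimal_exists:
  assumes X: "X \<in> \<A>" and [measurable]: "f \<in> borel_measurable M"
    and fin: "(\<integral>\<^sup>+u\<in>X. f u \<partial>M) < \<infinity>" and t: "0 \<le> t"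
  shows "\<exists>B. optimal X f t B"
proof -
  \<comment> \<open>Restricting both measures to \<open>X\<close> makes them finite, so that differences are meaningful.\<close>
  define N where "N = density M (\<lambda>u. f u * indicator X u)"
  define R where "R = density M (indicator X)"
  have Xs [measurable]: "X \<in> sets M" using core_sets[OF X] .
  have sets [simp]: "sets N = sets M" "sets R = sets M" by (simp_all add: N_def R_def)
  have [simp]: "space N = space M" "space R = space M" by (simp_all add: N_def R_def)
  have eN: "emeasure N H = (\<integral>\<^sup>+u\<in>H. f u \<partial>M)" and eR: "emeasure R H = emeasure M H"
    if "H \<in> sets M" "H \<subseteq> X" for H
  proof -
    have "emeasure N H = (\<integral>\<^sup>+u. f u * indicator X u * indicator H u \<partial>M)"
      using that(1) by (simp add: N_def emeasure_density)
    also have "\<dots> = (\<integral>\<^sup>+u\<in>H. f u \<partial>M)"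
      using that(2) by (intro nn_integral_cong) (auto split: split_indicator)
    finally show "emeasure N H = (\<integral>\<^sup>+u\<in>H. f u \<partial>M)" .
    have "emeasure R H = (\<integral>\<^sup>+u. indicator X u * indicator H u \<partial>M)"
      using that(1) by (simp add: R_def emeasure_density)
    also have "\<dots> = (\<integral>\<^sup>+u. indicator H u \<partial>M)"
      using that(2) by (intro nn_integral_cong) (auto split: split_indicator)
    finally show "emeasure R H = emeasure M H" using that(1) by simp
  qed
  have "emeasure N (space M) = (\<integral>\<^sup>+u\<in>X. f u \<partial>M)"
    by (auto simp: N_def emeasure_density intro!: nn_integral_cong split: split_indicator)
  then interpret N: finite_measure N using fin by (intro finite_measureI) auto
  have "emeasure R (space M) = (\<integral>\<^sup>+u. indicator X u \<partial>M)"
    by (auto simp: R_def emeasure_density intro!: nn_integral_cong split: split_indicator)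
  then interpret R: finite_measure R using core_finite[OF X] by (intro finite_measureI) auto
  define \<Phi> where "\<Phi> H = measure N H - t * measure R H" for H
  define \<D> where "\<D> = {H \<in> down_sets. H \<subseteq> X}"
  have Ds: "H \<in> sets M" if "H \<in> \<D>" for H using that down_sets_sets by (auto simp: \<D>_def)
  have bdd: "bdd_above (\<Phi> ` \<D>)"
  proof (rule bdd_aboveI2)
    fix H
    have "\<Phi> H \<le> measure N H" using t by (simp add: \<Phi>_def)
    also have "\<dots> \<le> measure N (space N)" by (rule N.bounded_measure)
    finally show "\<Phi> H \<le> measure N (space N)" .
  qed
  have ne: "\<D> \<noteq> {}" using empty_down_sets by (auto simp: \<D>_def)
  define S where "S = Sup (\<Phi> ` \<D>)"
  have "\<exists>B\<in>\<D>. S - 1 / real (Suc n) < \<Phi> B" for n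
  proof -
    have "S - 1 / real (Suc n) < Sup (\<Phi> ` \<D>)" by (simp add: S_def)
    then obtain y where "y \<in> \<Phi> ` \<D>" "S - 1 / real (Suc n) < y"
      using ne by (metis less_cSupE empty_is_image)
    then show ?thesis by blast
  qed
  then obtain B where B: "\<And>n. B n \<in> \<D>" "\<And>n. S - 1 / real (Suc n) < \<Phi> (B n)"
    by metis
  \<comment> \<open>A finite union of members of the chain is one of them, so no \<open>V m p\<close> falls below the bound for
    its first member; the upper limit \<open>Z\<close> of the maximizing sequence inherits the bound.\<close>
  define V where "V m p = (\<Union>i\<le>p. B (m + i))" for m p :: nat
  have V: "V m p \<in> \<D> \<and> S - 1 / real (Suc m) \<le> \<Phi> (V m p)" for m p
  proof (induction p)
    case 0
    show ?case using B[of m] by (simp add: V_def)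
  next
    case (Suc p)
    have "S - 1 / real (Suc m) \<le> S - 1 / real (Suc (m + Suc p))"
      by (simp add: frac_le)
    also have "\<dots> < \<Phi> (B (m + Suc p))" by (rule B(2))
    finally have b: "S - 1 / real (Suc m) \<le> \<Phi> (B (m + Suc p))" by simp
    have "V m (Suc p) = V m p \<union> B (m + Suc p)"
      by (auto simp: V_def atMost_Suc)
    moreover have "V m p \<subseteq> B (m + Suc p) \<or> B (m + Suc p) \<subseteq> V m p"
      using down_sets_chain Suc.IH B(1)[of "m + Suc p"] by (auto simp: \<D>_def)
    ultimately have "V m (Suc p) = V m p \<or> V m (Suc p) = B (m + Suc p)"
      by (auto simp: sup.absorb1 sup.absorb2)
    then show ?case using Suc.IH b B(1)[of "m + Suc p"] by auto
  qed
  define W where "W m = (\<Union>p. V m p)" for m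
  have W: "W m \<in> \<D>" for m
    using V by (auto simp: W_def \<D>_def intro!: down_sets_UN)
  have W_ge: "S - 1 / real (Suc m) \<le> \<Phi> (W m)" for m
  proof (rule LIMSEQ_le_const)
    have inc: "incseq (V m)" by (auto simp: incseq_def V_def intro: order_trans)
    show "(\<lambda>p. \<Phi> (V m p)) \<longlonglongrightarrow> \<Phi> (W m)"
      unfolding \<Phi>_def W_def using inc V Ds
      by (intro tendsto_diff tendsto_mult tendsto_const
          N.finite_Lim_measure_incseq R.finite_Lim_measure_incseq) auto
    show "\<exists>N. \<forall>p\<ge>N. S - 1 / real (Suc m) \<le> \<Phi> (V m p)" using V by blast
  qed
  define Z where "Z = (\<Inter>m. W m)"
  have Z: "Z \<in> \<D>"
    using W unfolding Z_def \<D>_def by (auto intro!: down_sets_INT)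
  have "S \<le> \<Phi> Z"
  proof (rule LIMSEQ_le)
    have dec: "decseq W"
    proof (rule decseq_SucI)
      fix m
      show "W (Suc m) \<subseteq> W m"
      proof
        fix x assume "x \<in> W (Suc m)"
        then obtain i where "x \<in> B (m + Suc i)" by (auto simp: W_def V_def)
        then show "x \<in> W m" unfolding W_def V_def by blast
      qed
    qed
    show "(\<lambda>m. \<Phi> (W m)) \<longlonglongrightarrow> \<Phi> Z"
      unfolding \<Phi>_def Z_def using dec W Ds
      by (intro tendsto_diff tendsto_mult tendsto_const
          N.finite_Lim_measure_decseq R.finite_Lim_measure_decseq) auto
    show "(\<lambda>m. S - 1 / real (Suc m)) \<longlonglongrightarrow> S"
      using tendsto_diff[OF tendsto_const LIMSEQ_inverse_real_of_nat, of S]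
      by (simp add: inverse_eq_divide)
    show "\<exists>N. \<forall>m\<ge>N. S - 1 / real (Suc m) \<le> \<Phi> (W m)" using W_ge by blast
  qed
  have "optimal X f t Z"
    unfolding optimal_def
  proof (intro conjI ballI impI)
    show "Z \<in> down_sets" "Z \<subseteq> X" using Z by (auto simp: \<D>_def)
    fix H assume "H \<in> down_sets" "H \<subseteq> X"
    then have H: "H \<in> \<D>" by (simp add: \<D>_def)
    have "\<Phi> H \<le> S" unfolding S_def using H bdd by (intro cSup_upper) auto
    also note \<open>S \<le> \<Phi> Z\<close>
    finally have "measure N H + t * measure R Z \<le> measure N Z + t * measure R H"
      by (simp add: \<Phi>_def)
    then have "ennreal (measure N H + t * measure R Z) \<le> ennreal (measure N Z + t * measure R H)"
      by (rule ennreal_leI)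
    then have "emeasure N H + ennreal t * emeasure R Z \<le> emeasure N Z + ennreal t * emeasure R H"
      using t by (simp add: N.emeasure_eq_measure R.emeasure_eq_measure ennreal_mult)
    then show "(\<integral>\<^sup>+u\<in>H. f u \<partial>M) + ennreal t * emeasure M Z
        \<le> (\<integral>\<^sup>+u\<in>Z. f u \<partial>M) + ennreal t * emeasure M H"
      using H Z Ds by (auto simp: eN eR \<D>_def)
  qed
  then show ?thesis by blast
qed

lemma emeasure_subset_core_finite:
  assumes "X \<in> \<A>" "B \<subseteq> X"
  shows "emeasure M B < \<infinity>"
  using emeasure_mono[OF assms(2) core_sets[OF assms(1)]] core_finite[OF assms(1)]
  by (rule le_less_trans)

text \<open>
  Adding \<open>E\<close> to the maximizer \<open>B\<close> cannot increase the functional, so \<open>f\<close> has mean at most \<open>t\<close> on the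
  part that is added.
\<close>

lemma optimal_outside_le:
  assumes X: "X \<in> \<A>" and f [measurable]: "f \<in> borel_measurable M"
    and fin: "(\<integral>\<^sup>+u\<in>X. f u \<partial>M) < \<infinity>"
    and B: "optimal X f t B" and E: "E \<in> down_sets" "E \<subseteq> X"
  shows "(\<integral>\<^sup>+u\<in>E - B. f u \<partial>M) \<le> ennreal t * emeasure M (E - B)"
proof -
  have Bd: "B \<in> down_sets" "B \<subseteq> X" using B by (auto simp: optimal_def)
  note [measurable] = down_sets_sets[OF Bd(1)] down_sets_sets[OF E(1)]
  have m: "emeasure M (B \<union> E) = emeasure M B + emeasure M (E - B)"
    by (subst plus_emeasure) (auto intro!: arg_cong[where f="emeasure M"])
  have i: "(\<integral>\<^sup>+u\<in>B \<union> E. f u \<partial>M) = (\<integral>\<^sup>+u\<in>B. f u \<partial>M) + (\<integral>\<^sup>+u\<in>E - B. f u \<partial>M)"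
    by (subst nn_integral_split[symmetric])
      (auto intro!: arg_cong[where f="\<lambda>S. set_nn_integral M S f"])
  have "(\<integral>\<^sup>+u\<in>B \<union> E. f u \<partial>M) + ennreal t * emeasure M B
        \<le> (\<integral>\<^sup>+u\<in>B. f u \<partial>M) + ennreal t * emeasure M (B \<union> E)"
    using B E Bd down_sets_Un[OF Bd(1) E(1)] by (auto simp: optimal_def)
  then have "((\<integral>\<^sup>+u\<in>B. f u \<partial>M) + ennreal t * emeasure M B) + (\<integral>\<^sup>+u\<in>E - B. f u \<partial>M)
        \<le> ((\<integral>\<^sup>+u\<in>B. f u \<partial>M) + ennreal t * emeasure M B) + ennreal t * emeasure M (E - B)"
    unfolding m i by (simp add: algebra_simps)
  moreover have "(\<integral>\<^sup>+u\<in>B. f u \<partial>M) + ennreal t * emeasure M B < \<infinity>"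
    using nn_integral_subset_finite[OF fin Bd(2)] emeasure_subset_core_finite[OF X Bd(2)]
    by (simp add: ennreal_mult_less_top)
  ultimately show ?thesis by (rule ennreal_add_le_cancel_left)
qed

text \<open>
  Removing everything outside \<open>E\<close> from the maximizer \<open>B\<close> cannot increase the functional, so \<open>f\<close> has mean
  at least \<open>t\<close> on the part that is removed.
\<close>

lemma optimal_inside_ge:
  assumes X: "X \<in> \<A>" and f [measurable]: "f \<in> borel_measurable M"
    and fin: "(\<integral>\<^sup>+u\<in>X. f u \<partial>M) < \<infinity>"
    and B: "optimal X f t B" and E: "E \<in> down_sets"
  shows "ennreal t * emeasure M (B - E) \<le> (\<integral>\<^sup>+u\<in>B - E. f u \<partial>M)"
proof -
  have Bd: "B \<in> down_sets" "B \<subseteq> X" using B by (auto simp: optimal_def)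
  note [measurable] = down_sets_sets[OF Bd(1)] down_sets_sets[OF E(1)]
  have m: "emeasure M B = emeasure M (B \<inter> E) + emeasure M (B - E)"
    by (subst plus_emeasure) (auto intro!: arg_cong[where f="emeasure M"])
  have i: "(\<integral>\<^sup>+u\<in>B. f u \<partial>M) = (\<integral>\<^sup>+u\<in>B \<inter> E. f u \<partial>M) + (\<integral>\<^sup>+u\<in>B - E. f u \<partial>M)"
    by (subst nn_integral_split[symmetric])
      (auto intro!: arg_cong[where f="\<lambda>S. set_nn_integral M S f"])
  have "(\<integral>\<^sup>+u\<in>B \<inter> E. f u \<partial>M) + ennreal t * emeasure M B
        \<le> (\<integral>\<^sup>+u\<in>B. f u \<partial>M) + ennreal t * emeasure M (B \<inter> E)"
    using B Bd down_sets_Int[OF Bd(1) E] by (auto simp: optimal_def)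
  then have "((\<integral>\<^sup>+u\<in>B \<inter> E. f u \<partial>M) + ennreal t * emeasure M (B \<inter> E)) + ennreal t * emeasure M (B - E)
        \<le> ((\<integral>\<^sup>+u\<in>B \<inter> E. f u \<partial>M) + ennreal t * emeasure M (B \<inter> E)) + (\<integral>\<^sup>+u\<in>B - E. f u \<partial>M)"
    unfolding m i by (simp add: algebra_simps)
  moreover have "(\<integral>\<^sup>+u\<in>B \<inter> E. f u \<partial>M) + ennreal t * emeasure M (B \<inter> E) < \<infinity>"
    using nn_integral_subset_finite[OF fin, of "B \<inter> E"]
      emeasure_subset_core_finite[OF X, of "B \<inter> E"] Bd(2)
    by (auto simp: ennreal_mult_less_top)
  ultimately show ?thesis by (rule ennreal_add_le_cancel_left)
qed

text \<open>
  On \<open>B - B'\<close> the mean of \<open>f\<close> is at least \<open>t\<close> and that of \<open>f'\<close> is at most \<open>s\<close>. With \<open>f = f'\<close> this yields that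
  maximizers are nested, and in general that the construction is monotone in the function.
\<close>

lemma optimal_comparison:
  assumes X: "X \<in> \<A>" "X' \<in> \<A>" "X \<subseteq> X'"
    and f [measurable]: "f \<in> borel_measurable M" "f' \<in> borel_measurable M"
    and fin: "(\<integral>\<^sup>+u\<in>X. f u \<partial>M) < \<infinity>" "(\<integral>\<^sup>+u\<in>X'. f' u \<partial>M) < \<infinity>"
    and le: "AE u in M. f u \<le> f' u"
    and B: "optimal X f t B" and B': "optimal X' f' s B'" and st: "0 \<le> s" "s < t"
  shows "emeasure M (B - B') = 0"
proof (rule ccontr)
  assume nz: "emeasure M (B - B') \<noteq> 0"
  have Bd: "B \<in> down_sets" "B \<subseteq> X" "B' \<in> down_sets" using B B' by (auto simp: optimal_def)
  have "ennreal t * emeasure M (B - B') \<le> (\<integral>\<^sup>+u\<in>B - B'. f u \<partial>M)"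
    by (rule optimal_inside_ge[OF X(1) f(1) fin(1) B Bd(3)])
  also have "\<dots> \<le> (\<integral>\<^sup>+u\<in>B - B'. f' u \<partial>M)"
    using le by (intro nn_integral_mono_AE) (auto split: split_indicator)
  also have "\<dots> \<le> ennreal s * emeasure M (B - B')"
    using Bd X by (intro optimal_outside_le[OF X(2) f(2) fin(2) B']) auto
  finally have "ennreal t * emeasure M (B - B') \<le> ennreal s * emeasure M (B - B')" .
  moreover have "emeasure M (B - B') < \<infinity>"
    using Bd(2) by (intro emeasure_subset_core_finite[OF X(1)]) auto
  ultimately show False
    using nz st by (cases "emeasure M (B - B')")
      (auto simp: ennreal_mult[symmetric] ennreal_le_iff)
qed

lemma optimal_empty:
  assumes C: "\<And>u. f u \<le> ennreal C * indicator X u" and t: "C < t"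
  shows "optimal X f t {}"
  unfolding optimal_def
proof (intro conjI ballI impI)
  fix H assume H: "H \<in> down_sets" "H \<subseteq> X"
  have "f u * indicator H u \<le> ennreal t * indicator H u" for u
    using C[of u] H(2) ennreal_leI[of C t] t by (auto split: split_indicator intro: order_trans)
  then have "(\<integral>\<^sup>+u\<in>H. f u \<partial>M) \<le> (\<integral>\<^sup>+u. ennreal t * indicator H u \<partial>M)"
    by (rule nn_integral_mono)
  also have "\<dots> = ennreal t * emeasure M H"
    using down_sets_sets[OF H(1)] by (rule nn_integral_cmult_indicator)
  finally show "(\<integral>\<^sup>+u\<in>H. f u \<partial>M) + ennreal t * emeasure M {}
      \<le> (\<integral>\<^sup>+u\<in>{}. f u \<partial>M) + ennreal t * emeasure M H" by simp
qed (auto simp: empty_down_sets)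

lemma optimal_null_extension:
  assumes opt: "optimal X f t B" and B': "B' \<in> down_sets" "B' \<subseteq> X" "B \<subseteq> B'"
    and null: "emeasure M (B' - B) = 0"
  shows "optimal X f t B'"
proof -
  have Bd: "B \<in> down_sets" using opt by (simp add: optimal_def)
  note [measurable] = down_sets_sets[OF Bd] down_sets_sets[OF B'(1)]
  have "B' - B \<in> null_sets M" using null by auto
  then have ae: "AE u in M. u \<in> B' \<longleftrightarrow> u \<in> B"
    using B'(3) by (auto dest!: AE_not_in elim!: eventually_mono)
  then have "emeasure M B' = emeasure M B" by (intro emeasure_eq_AE) auto
  moreover have "(\<integral>\<^sup>+u\<in>B'. f u \<partial>M) = (\<integral>\<^sup>+u\<in>B. f u \<partial>M)"
    using ae by (intro nn_integral_cong_AE) (auto simp: indicator_def)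
  ultimately show ?thesis using opt B' unfolding optimal_def by auto
qed

section \<open>The envelope of a family of maximizers\<close>

text \<open>
  The functions for which level functions are constructed directly. Boundedness allows the
  maximizers for large thresholds to be empty.
\<close>

definition tame :: "'a set \<Rightarrow> ('a \<Rightarrow> ennreal) \<Rightarrow> bool" where
  "tame X f \<longleftrightarrow> X \<in> \<A> \<and> f \<in> borel_measurable M \<and> (\<exists>C. \<forall>u. f u \<le> ennreal C * indicator X u)"

lemma tame_finite:
  assumes "tame X f"
  shows "(\<integral>\<^sup>+u\<in>X. f u \<partial>M) < \<infinity>"
proof -
  obtain C where C: "\<And>u. f u \<le> ennreal C * indicator X u"
    using assms by (auto simp: tame_def)
  have X: "X \<in> \<A>" using assms by (simp add: tame_def)
  have "(\<integral>\<^sup>+u\<in>X. f u \<partial>M) \<le> (\<integral>\<^sup>+u. ennreal C * indicator X u \<partial>M)"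
    using C by (intro nn_integral_mono) (metis indicator_simps mult.right_neutral mult_zero_right order_refl)
  also have "\<dots> = ennreal C * emeasure M X"
    using core_sets[OF X] by (rule nn_integral_cmult_indicator)
  also have "\<dots> < \<infinity>" using core_finite[OF X] by (simp add: ennreal_mult_less_top)
  finally show ?thesis .
qed

definition level_family :: "'a set \<Rightarrow> ('a \<Rightarrow> ennreal) \<Rightarrow> (real \<Rightarrow> 'a set) \<Rightarrow> bool" where
  "level_family X f B \<longleftrightarrow> (\<forall>t\<in>pos_rats. optimal X f t (B t)) \<and>
     (\<forall>s\<in>pos_rats. \<forall>t\<in>pos_rats. s \<le> t \<longrightarrow> B t \<subseteq> B s) \<and>
     (\<exists>C. \<forall>t\<in>pos_rats. C < t \<longrightarrow> B t = {})"

lemma level_family_exists: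
  assumes "tame X f"
  shows "\<exists>B. level_family X f B"
proof -
  have X: "X \<in> \<A>" and f: "f \<in> borel_measurable M" using assms by (auto simp: tame_def)
  obtain C where C: "\<And>u. f u \<le> ennreal C * indicator X u"
    using assms by (auto simp: tame_def)
  have "\<exists>B. optimal X f t B \<and> (C < t \<longrightarrow> B = {})" if "0 \<le> t" for t
    using optimal_exists[OF X f tame_finite[OF assms] that] optimal_empty[OF C] by metis
  then obtain B0 where B0: "\<And>t. 0 \<le> t \<Longrightarrow> optimal X f t (B0 t)"
      "\<And>t. 0 \<le> t \<Longrightarrow> C < t \<Longrightarrow> B0 t = {}"
    by metis
  \<comment> \<open>Maximizers for larger thresholds are almost contained in those for smaller ones. Absorbing
    them changes each set by a null set and makes the family nested everywhere.\<close>
  define Q where "Q t = {q \<in> pos_rats. t \<le> q}" for t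
  have Q: "countable (Q t)" for t
    using countable_pos_rats by (auto simp: Q_def intro: countable_subset)
  have Qpos: "0 \<le> q" if "q \<in> Q t" for q t using that by (simp add: Q_def pos_rats_def)
  define B where "B t = (\<Union>q\<in>Q t. B0 q)" for t
  have down0: "B0 q \<in> down_sets" "B0 q \<subseteq> X" if "0 \<le> q" for q
    using B0(1)[OF that] by (auto simp: optimal_def)
  have "optimal X f t (B t)" if t: "t \<in> pos_rats" for t
  proof (rule optimal_null_extension)
    have t0: "0 \<le> t" "t \<in> Q t" using t by (auto simp: pos_rats_def Q_def)
    show "optimal X f t (B0 t)" by (rule B0(1)[OF t0(1)])
    show "B t \<in> down_sets" "B t \<subseteq> X"
      using Q Qpos down0 unfolding B_def by (blast intro!: down_sets_UN)+
    show "B0 t \<subseteq> B t" using t0 unfolding B_def by blast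
    have "B0 q - B0 t \<in> null_sets M" if "q \<in> Q t" for q
    proof -
      have "emeasure M (B0 q - B0 t) = 0"
      proof (cases "q = t")
        case False
        with that have "t < q" by (simp add: Q_def)
        with t0 that Qpos show ?thesis
          by (intro optimal_comparison[OF X X order_refl f f tame_finite tame_finite _ B0(1) B0(1)])
             (auto intro: assms)
      qed simp
      then show ?thesis
        using down_sets_sets[OF down0(1)[OF Qpos[OF that]]] down_sets_sets[OF down0(1)[OF t0(1)]]
        by (auto intro!: null_setsI)
    qed
    then have "(\<Union>q\<in>Q t. B0 q - B0 t) \<in> null_sets M" using Q by (intro null_sets_UN') auto
    then show "emeasure M (B t - B0 t) = 0"
      unfolding B_def UN_extend_simps by (auto simp: null_sets_def)
  qed
  moreover have "B t \<subseteq> B s" if "s \<le> t" for s t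
    using that unfolding B_def Q_def by fastforce
  moreover have "B t = {}" if "C < t" for t
    using that B0(2) Qpos unfolding B_def by (force simp: Q_def)
  ultimately show ?thesis unfolding level_family_def by blast
qed

lemma level_familyD:
  assumes "level_family X f B" "t \<in> pos_rats"
  shows "optimal X f t (B t)" "B t \<in> down_sets" "B t \<subseteq> X"
  using assms by (auto simp: level_family_def optimal_def)

lemma level_family_antimono:
  "level_family X f B \<Longrightarrow> s \<in> pos_rats \<Longrightarrow> t \<in> pos_rats \<Longrightarrow> s \<le> t \<Longrightarrow> B t \<subseteq> B s"
  by (auto simp: level_family_def)

text \<open>
  For a nested family, \<open>B t\<close> lies between the strict and the weak superlevel set of this function at \<open>t\<close>.
\<close>

definition envelope :: "(real \<Rightarrow> 'a set) \<Rightarrow> 'a \<Rightarrow> ennreal" where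
  "envelope B u = (SUP t\<in>pos_rats. ennreal t * indicator (B t) u)"

lemma envelope_core_decreasing:
  assumes "level_family X f B"
  shows "envelope B \<in> core_decreasing M \<A>"
proof -
  have "(\<lambda>u. SUP t\<in>pos_rats. ennreal t * indicator (B t) u) \<in> core_decreasing M \<A>"
    using level_familyD[OF assms]
    by (intro core_decreasing_SUP countable_pos_rats indicator_core_decreasing)
  then show ?thesis by (simp add: envelope_def[abs_def])
qed

lemma envelope_ge:
  assumes "t \<in> pos_rats" "u \<in> B t"
  shows "ennreal t \<le> envelope B u"
  unfolding envelope_def by (rule SUP_upper2[OF assms(1)]) (simp add: assms)

lemma envelope_le:
  assumes B: "level_family X f B" and t: "t \<in> pos_rats" and u: "u \<notin> B t"
  shows "envelope B u \<le> ennreal t"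
  unfolding envelope_def
proof (rule SUP_least)
  fix q assume q: "q \<in> pos_rats"
  show "ennreal q * indicator (B q) u \<le> ennreal t"
  proof (cases "u \<in> B q")
    case True
    then have "q < t" using level_family_antimono[OF B t q] u by force
    with True show ?thesis by (simp add: ennreal_leI)
  qed simp
qed

lemma envelope_zero:
  assumes B: "level_family X f B" and u: "u \<notin> X"
  shows "envelope B u = 0"
proof -
  have "ennreal q * indicator (B q) u = 0" if "q \<in> pos_rats" for q
    using level_familyD(3)[OF B that] u by (auto simp: indicator_def)
  then have "envelope B u \<le> 0" unfolding envelope_def by (intro SUP_least) simp
  then show ?thesis by simp
qed

text \<open>
  If \<open>envelope B' u < s < t < envelope B u\<close>, then \<open>u\<close> is in \<open>B t - B' s\<close>, which is null.
\<close>

lemma envelope_mono: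
  assumes f: "tame X f" "tame X' f'" "X \<subseteq> X'" and le: "AE u in M. f u \<le> f' u"
    and B: "level_family X f B" and B': "level_family X' f' B'"
  shows "AE u in M. envelope B u \<le> envelope B' u"
proof -
  have "AE u in M. u \<notin> B t - B' s" if st: "s \<in> pos_rats" "t \<in> pos_rats" "s < t" for s t
  proof (rule AE_not_in, rule null_setsI)
    show "emeasure M (B t - B' s) = 0"
      using f st by (intro optimal_comparison[OF _ _ f(3) _ _ tame_finite[OF f(1)] tame_finite[OF f(2)]
          le level_familyD(1)[OF B] level_familyD(1)[OF B']]) (auto simp: tame_def pos_rats_def)
    show "B t - B' s \<in> sets M"
      using level_familyD(2)[OF B st(2)] level_familyD(2)[OF B' st(1)] down_sets_sets by blast
  qed
  then have "AE u in M. \<forall>s\<in>pos_rats. \<forall>t\<in>pos_rats. s < t \<longrightarrow> u \<in> B t \<longrightarrow> u \<in> B' s"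
    by (simp add: AE_ball_countable[OF countable_pos_rats])
  then show ?thesis
  proof (rule eventually_mono)
    fix u assume u: "\<forall>s\<in>pos_rats. \<forall>t\<in>pos_rats. s < t \<longrightarrow> u \<in> B t \<longrightarrow> u \<in> B' s"
    show "envelope B u \<le> envelope B' u"
    proof (rule ccontr)
      assume "\<not> envelope B u \<le> envelope B' u"
      then obtain s where s: "s \<in> pos_rats" "envelope B' u < ennreal s" "ennreal s < envelope B u"
        by (meson not_le pos_rats_dense)
      then obtain t where t: "t \<in> pos_rats" "ennreal s < ennreal t" "ennreal t < envelope B u"
        by (meson pos_rats_dense)
      have "s < t" using t(2) by (metis ennreal_leI not_le)
      moreover have "u \<in> B t" using envelope_le[OF B t(1)] t(3) by (meson not_le)
      ultimately have "u \<in> B' s" using u s(1) t(1) by blast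
      then show False using envelope_ge[OF s(1)] s(2) by (meson not_le)
    qed
  qed
qed

section \<open>The envelope is a level function\<close>

text \<open>
  The values of \<open>g\<close> on \<open>D \<inter> A\<close> dominate those on \<open>D - A\<close>, so the mean over \<open>D\<close> is at most the mean over
  \<open>D \<inter> A\<close>. Replacing \<open>g\<close> by its means over layers therefore does not increase integrals over the core.
\<close>

lemma mean_down_set_le:
  assumes g: "g \<in> core_decreasing M \<A>" and A: "A \<in> down_sets"
    and D: "D \<in> sets M" "emeasure M D < \<infinity>"
  shows "mean M g D * emeasure M (D \<inter> A) \<le> (\<integral>\<^sup>+u\<in>D \<inter> A. g u \<partial>M)"
proof (cases "emeasure M D = 0")
  case True
  then have "emeasure M (D \<inter> A) = 0" using D(1) emeasure_mono[of "D \<inter> A" D M] by auto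
  then show ?thesis by simp
next
  case False
  note [measurable] = core_decreasing_measurable[OF g] down_sets_sets[OF A] D(1)
  define x where "x = emeasure M (D \<inter> A)"
  define y where "y = emeasure M (D - A)"
  define p where "p = (\<integral>\<^sup>+u\<in>D \<inter> A. g u \<partial>M)"
  define q where "q = (\<integral>\<^sup>+u\<in>D - A. g u \<partial>M)"
  define c where "c = (SUP v\<in>D - A. g v)"
  have xy: "emeasure M D = x + y"
    unfolding x_def y_def by (subst plus_emeasure) (auto intro!: arg_cong[where f="emeasure M"])
  have pq: "(\<integral>\<^sup>+u\<in>D. g u \<partial>M) = p + q"
    unfolding p_def q_def by (subst nn_integral_split[symmetric])
      (auto intro!: arg_cong[where f="\<lambda>S. set_nn_integral M S g"])
  have "q \<le> (\<integral>\<^sup>+u. c * indicator (D - A) u \<partial>M)"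
    unfolding q_def c_def by (intro nn_integral_mono) (auto split: split_indicator intro: SUP_upper)
  then have q: "q \<le> c * y" unfolding y_def by (simp add: nn_integral_cmult_indicator)
  have "c \<le> g u" if "u \<in> D \<inter> A" for u
    unfolding c_def using that sets.sets_into_space[OF D(1)]
    by (intro SUP_least core_decreasing_le[OF g A]) auto
  then have "(\<integral>\<^sup>+u. c * indicator (D \<inter> A) u \<partial>M) \<le> p"
    unfolding p_def by (intro nn_integral_mono) (auto split: split_indicator)
  then have p: "c * x \<le> p" unfolding x_def by (simp add: nn_integral_cmult_indicator)
  have "q * x \<le> c * y * x" using q by (rule mult_right_mono) simp
  also have "\<dots> = c * x * y" by (simp add: ac_simps)
  also have "\<dots> \<le> p * y" using p by (rule mult_right_mono) simp
  finally have "(p + q) * x \<le> p * (x + y)"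
    by (simp add: algebra_simps)
  then have "(p + q) * x / emeasure M D \<le> p * emeasure M D / emeasure M D"
    unfolding xy by (rule divide_right_mono_ennreal)
  also have "p * emeasure M D / emeasure M D = p"
    using False D(2) by (simp add: ennreal_mult_divide_eq)
  also have "(p + q) * x / emeasure M D = mean M g D * x"
    using False pq by (simp add: mean_def divide_ennreal_def ac_simps)
  finally show ?thesis unfolding x_def p_def .
qed

text \<open>
  The sets \<open>B t\<close> at the multiples of \<open>\<delta>\<close>. Level zero is \<open>X\<close>, because the envelope vanishes off \<open>X\<close> and
  the layers are to exhaust \<open>X\<close>.
\<close>

definition grid :: "'a set \<Rightarrow> (real \<Rightarrow> 'a set) \<Rightarrow> real \<Rightarrow> nat \<Rightarrow> 'a set" where
  "grid X B \<delta> j = (if j = 0 then X else B (real j * \<delta>))"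

definition layer :: "'a set \<Rightarrow> (real \<Rightarrow> 'a set) \<Rightarrow> real \<Rightarrow> nat \<Rightarrow> 'a set" where
  "layer X B \<delta> j = grid X B \<delta> j - grid X B \<delta> (Suc j)"

lemma grid_rat: "\<delta> \<in> pos_rats \<Longrightarrow> j \<noteq> 0 \<Longrightarrow> real j * \<delta> \<in> pos_rats"
  by (auto simp: pos_rats_def)

text \<open>
  The layers exhaust \<open>X\<close> because the grid sets are eventually empty.
\<close>

lemma
  assumes f: "tame X f" and B: "level_family X f B" and \<delta>: "\<delta> \<in> pos_rats"
  shows grid_down_sets: "grid X B \<delta> j \<in> down_sets"
    and grid_subset: "grid X B \<delta> j \<subseteq> X"
    and grid_decseq: "decseq (grid X B \<delta>)"
    and layer_sets: "layer X B \<delta> j \<in> sets M"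
    and layer_finite: "emeasure M (layer X B \<delta> j) < \<infinity>"
    and layer_disjoint: "disjoint_family (layer X B \<delta>)"
    and layer_Union: "(\<Union>j. layer X B \<delta> j) = X"
proof -
  have X: "X \<in> \<A>" using f by (simp add: tame_def)
  show d: "grid X B \<delta> j \<in> down_sets" for j
    using level_familyD(2)[OF B grid_rat[OF \<delta>]] core_down_sets[OF X] by (auto simp: grid_def)
  show s: "grid X B \<delta> j \<subseteq> X" for j
    using level_familyD(3)[OF B grid_rat[OF \<delta>]] by (auto simp: grid_def)
  show dec: "decseq (grid X B \<delta>)"
  proof (rule decseq_SucI)
    fix j
    show "grid X B \<delta> (Suc j) \<subseteq> grid X B \<delta> j"
    proof (cases "j = 0")
      case True then show ?thesis using s[of "Suc 0"] by (simp add: grid_def)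
    next
      case False
      then show ?thesis
        using level_family_antimono[OF B grid_rat[OF \<delta> False] grid_rat[OF \<delta>, of "Suc j"]] \<delta>
        by (auto simp: grid_def pos_rats_def)
    qed
  qed
  show "layer X B \<delta> j \<in> sets M" using d down_sets_sets unfolding layer_def by blast
  show "emeasure M (layer X B \<delta> j) < \<infinity>"
    using s unfolding layer_def by (intro emeasure_subset_core_finite[OF X]) blast
  show "disjoint_family (layer X B \<delta>)"
  proof -
    have "layer X B \<delta> i \<inter> layer X B \<delta> j = {}" if "i < j" for i j
      using decseqD[OF dec, of "Suc i" j] that unfolding layer_def by auto
    then show ?thesis
      unfolding disjoint_family_on_def by (metis inf_commute linorder_neqE_nat)
  qed
  obtain C where C: "\<And>t. t \<in> pos_rats \<Longrightarrow> C < t \<Longrightarrow> B t = {}"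
    using B unfolding level_family_def by blast
  obtain n where n: "C < real n * \<delta>"
    using \<delta> reals_Archimedean3[of \<delta>] by (auto simp: pos_rats_def)
  show "(\<Union>j. layer X B \<delta> j) = X"
  proof
    show "(\<Union>j. layer X B \<delta> j) \<subseteq> X" using s unfolding layer_def by blast
    show "X \<subseteq> (\<Union>j. layer X B \<delta> j)"
    proof
      fix u assume u: "u \<in> X"
      have "C < real (Suc n) * \<delta>" using n \<delta> by (auto simp: pos_rats_def algebra_simps)
      then have "u \<notin> grid X B \<delta> (Suc n)"
        using C[OF grid_rat[OF \<delta>, of "Suc n"]] by (auto simp: grid_def)
      then obtain k where k: "u \<notin> grid X B \<delta> k" "\<And>i. i < k \<Longrightarrow> u \<in> grid X B \<delta> i"
        using exists_least_iff[of "\<lambda>k. u \<notin> grid X B \<delta> k"] by blast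
      then have "k \<noteq> 0" using u by (intro notI) (simp add: grid_def)
      then obtain j where "k = Suc j" by (cases k) auto
      with k show "u \<in> (\<Union>j. layer X B \<delta> j)" unfolding layer_def by blast
    qed
  qed
qed

lemma
  assumes B: "level_family X f B" and \<delta>: "\<delta> \<in> pos_rats"
    and u: "u \<in> layer X B \<delta> j"
  shows envelope_layer_ge: "ennreal (real j * \<delta>) \<le> envelope B u"
    and envelope_layer_le: "envelope B u \<le> ennreal (real (Suc j) * \<delta>)"
proof -
  show "ennreal (real j * \<delta>) \<le> envelope B u"
    using u envelope_ge[OF grid_rat[OF \<delta>]] by (cases "j = 0") (auto simp: layer_def grid_def)
  show "envelope B u \<le> ennreal (real (Suc j) * \<delta>)"
    using u envelope_le[OF B grid_rat[OF \<delta>, of "Suc j"]] by (auto simp: layer_def grid_def)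
qed

text \<open>
  A layer intersected with a down-set is what a down-set in \<open>X\<close> adds to the maximizer at the upper
  threshold of the layer.
\<close>

lemma layer_upper:
  assumes f: "tame X f" and B: "level_family X f B" and \<delta>: "\<delta> \<in> pos_rats" and H: "H \<in> down_sets"
  shows "(\<integral>\<^sup>+u\<in>layer X B \<delta> j \<inter> H. f u \<partial>M) \<le> ennreal (real (Suc j) * \<delta>) * emeasure M (layer X B \<delta> j \<inter> H)"
proof -
  have eq: "layer X B \<delta> j \<inter> H = (grid X B \<delta> j \<inter> H) - B (real (Suc j) * \<delta>)"
    by (auto simp: layer_def grid_def)
  have "grid X B \<delta> j \<inter> H \<in> down_sets" "grid X B \<delta> j \<inter> H \<subseteq> X"
    using grid_down_sets[OF f B \<delta>] grid_subset[OF f B \<delta>] H by (auto intro: down_sets_Int)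
  then show ?thesis
    unfolding eq using f
    by (intro optimal_outside_le[OF _ _ tame_finite[OF f] level_familyD(1)[OF B grid_rat[OF \<delta>, of "Suc j"]]])
      (auto simp: tame_def)
qed

text \<open>
  A layer is what is removed from the maximizer at its lower threshold. In the bottom layer that
  threshold is zero.
\<close>

lemma layer_lower:
  assumes f: "tame X f" and B: "level_family X f B" and \<delta>: "\<delta> \<in> pos_rats"
  shows "ennreal (real j * \<delta>) * emeasure M (layer X B \<delta> j) \<le> (\<integral>\<^sup>+u\<in>layer X B \<delta> j. f u \<partial>M)"
proof (cases "j = 0")
  case False
  have eq: "layer X B \<delta> j = B (real j * \<delta>) - grid X B \<delta> (Suc j)"
    using False by (auto simp: layer_def grid_def)
  show ?thesis
    unfolding eq using f grid_down_sets[OF f B \<delta>]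
    by (intro optimal_inside_ge[OF _ _ tame_finite[OF f] level_familyD(1)[OF B grid_rat[OF \<delta> False]]])
      (auto simp: tame_def)
qed simp

text \<open>
  In each layer the envelope differs from the upper threshold by at most \<open>\<delta>\<close>. This says that the
  primitive of the envelope majorizes that of \<open>f\<close>.
\<close>

lemma envelope_majorizes:
  assumes f: "tame X f" and B: "level_family X f B" and H: "H \<in> down_sets"
  shows "(\<integral>\<^sup>+u\<in>H. f u \<partial>M) \<le> (\<integral>\<^sup>+u\<in>H. envelope B u \<partial>M)"
proof (rule ennreal_le_rat_epsilon)
  have X: "X \<in> \<A>" using f by (simp add: tame_def)
  have fm [measurable]: "f \<in> borel_measurable M" using f by (simp add: tame_def)
  have f0: "f u = 0" if "u \<notin> X" for u
    using f that unfolding tame_def by (metis indicator_simps(2) le_zero_eq mult_zero_right)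
  note [measurable] = core_sets[OF X] down_sets_sets[OF H]
    core_decreasing_measurable[OF envelope_core_decreasing[OF B]]
  show "emeasure M X < \<infinity>" by (rule core_finite[OF X])
  fix \<delta> assume \<delta>: "\<delta> \<in> pos_rats"
  note [measurable] = layer_sets[OF f B \<delta>]
  let ?D = "layer X B \<delta>"
  have "(\<integral>\<^sup>+u\<in>H. f u \<partial>M) = (\<integral>\<^sup>+u\<in>(\<Union>j. ?D j). f u * indicator H u \<partial>M)"
    unfolding layer_Union[OF f B \<delta>] using f0
    by (intro nn_integral_cong) (auto split: split_indicator)
  also have "\<dots> \<le> (\<integral>\<^sup>+u\<in>(\<Union>j. ?D j). (envelope B u + ennreal \<delta>) * indicator H u \<partial>M)"
  proof (rule nn_integral_piecewise_le)
    fix j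
    have "(\<integral>\<^sup>+u\<in>?D j \<inter> H. f u \<partial>M) \<le> ennreal (real (Suc j) * \<delta>) * emeasure M (?D j \<inter> H)"
      by (rule layer_upper[OF f B \<delta> H])
    also have "\<dots> = (\<integral>\<^sup>+u. ennreal (real (Suc j) * \<delta>) * indicator (?D j \<inter> H) u \<partial>M)"
      by (rule nn_integral_cmult_indicator[symmetric]) measurable
    also have "\<dots> \<le> (\<integral>\<^sup>+u\<in>?D j \<inter> H. envelope B u + ennreal \<delta> \<partial>M)"
    proof (rule nn_integral_mono)
      fix u
      show "ennreal (real (Suc j) * \<delta>) * indicator (?D j \<inter> H) u
          \<le> (envelope B u + ennreal \<delta>) * indicator (?D j \<inter> H) u"
      proof (cases "u \<in> ?D j")
        case True
        have "ennreal (real (Suc j) * \<delta>) = ennreal (real j * \<delta>) + ennreal \<delta>"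
          using \<delta> by (subst ennreal_plus[symmetric]) (auto simp: pos_rats_def algebra_simps)
        also have "\<dots> \<le> envelope B u + ennreal \<delta>"
          by (intro add_right_mono envelope_layer_ge[OF B \<delta> True])
        finally show ?thesis by (rule mult_right_mono) simp
      qed simp
    qed
    finally show "(\<integral>\<^sup>+u\<in>?D j. f u * indicator H u \<partial>M)
        \<le> (\<integral>\<^sup>+u\<in>?D j. (envelope B u + ennreal \<delta>) * indicator H u \<partial>M)"
      by (simp only: indicator_mult_nn_integral)
  qed (use layer_disjoint[OF f B \<delta>] in auto)
  also have "\<dots> \<le> (\<integral>\<^sup>+u. envelope B u * indicator H u + ennreal \<delta> * indicator X u \<partial>M)"
    unfolding layer_Union[OF f B \<delta>]
    by (intro nn_integral_mono) (auto split: split_indicator)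
  also have "\<dots> = (\<integral>\<^sup>+u\<in>H. envelope B u \<partial>M) + ennreal \<delta> * emeasure M X"
    by (subst nn_integral_add) (auto simp: nn_integral_cmult_indicator)
  finally show "(\<integral>\<^sup>+u\<in>H. f u \<partial>M) \<le> (\<integral>\<^sup>+u\<in>H. envelope B u \<partial>M) + ennreal \<delta> * emeasure M X" .
qed

text \<open>
  Let \<open>h\<close> be the mean of \<open>g\<close> over each layer. On a layer the envelope is nearly constant and has nearly
  the same integral as \<open>f\<close>, so that pairing the envelope with \<open>g\<close>, pairing it with \<open>h\<close>, and pairing \<open>f\<close>
  with \<open>h\<close> give nearly the same value.
\<close>

lemma envelope_nearly_attained:
  assumes f: "tame X f" and B: "level_family X f B" and g: "g \<in> core_decreasing M \<A>"
    and \<delta>: "\<delta> \<in> pos_rats"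
  shows "\<exists>h\<in>core_decreasing M \<A>.
    (\<forall>A\<in>\<A>. (\<integral>\<^sup>+u\<in>A. h u \<partial>M) \<le> (\<integral>\<^sup>+u\<in>A. g u \<partial>M)) \<and>
    (\<integral>\<^sup>+u. envelope B u * g u \<partial>M) \<le> (\<integral>\<^sup>+u. f u * h u \<partial>M) + ennreal \<delta> * (\<integral>\<^sup>+u\<in>X. g u \<partial>M)"
proof -
  have X: "X \<in> \<A>" using f by (simp add: tame_def)
  have fm [measurable]: "f \<in> borel_measurable M" using f by (simp add: tame_def)
  note [measurable] = core_sets[OF X] core_decreasing_measurable[OF g] layer_sets[OF f B \<delta>]
    core_decreasing_measurable[OF envelope_core_decreasing[OF B]]
  let ?G = "grid X B \<delta>" and ?D = "layer X B \<delta>"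
  note fin = layer_finite[OF f B \<delta>]
  define c where "c j = mean M g (?D j)" for j
  \<comment> \<open>Empty layers are left out: the mean over the empty set is \<open>\<infinity>\<close> and would spoil the supremum. As a
    supremum of multiples of indicators of down-sets, \<open>h\<close> is core decreasing by construction; as
    the means increase with the layer, it equals \<open>c j\<close> on layer \<open>j\<close>.\<close>
  define J where "J = {j. ?D j \<noteq> {}}"
  define h where "h u = (SUP j\<in>J. c j * indicator (?G j) u)" for u
  have h: "h \<in> core_decreasing M \<A>"
    unfolding h_def[abs_def] using grid_down_sets[OF f B \<delta>]
    by (intro core_decreasing_SUP indicator_core_decreasing) auto
  note [measurable] = core_decreasing_measurable[OF h]
  have c_mono: "c i \<le> c j" if "i < j" "?D i \<noteq> {}" for i j
    unfolding c_def
  proof (intro mean_le mean_ge that(2) layer_sets[OF f B \<delta>] fin)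
    fix u v assume uv: "u \<in> ?D i" "v \<in> ?D j"
    have "?G j \<subseteq> ?G (Suc i)" using grid_decseq[OF f B \<delta>] that(1) by (auto simp: decseq_def)
    then have "v \<in> ?G (Suc i)" "u \<in> space M - ?G (Suc i)"
      using uv sets.sets_into_space[OF layer_sets[OF f B \<delta>, of i]] by (auto simp: layer_def)
    then show "g u \<le> g v" using core_decreasing_le[OF g grid_down_sets[OF f B \<delta>]] by blast
  qed
  have h_eq: "h u = c j" if u: "u \<in> ?D j" for u j
  proof (rule antisym)
    show "h u \<le> c j"
      unfolding h_def
    proof (rule SUP_least)
      fix i assume i: "i \<in> J"
      show "c i * indicator (?G i) u \<le> c j"
      proof (cases "u \<in> ?G i")
        case True
        have "\<not> j < i"
        proof
          assume "j < i"
          then have "?G i \<subseteq> ?G (Suc j)" using grid_decseq[OF f B \<delta>] by (auto simp: decseq_def)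
          then show False using True u by (auto simp: layer_def)
        qed
        then have "c i \<le> c j" using c_mono[of i j] i by (cases "i = j") (auto simp: J_def)
        then show ?thesis using True by simp
      qed simp
    qed
    show "c j \<le> h u"
      unfolding h_def using u by (intro SUP_upper2[of j]) (auto simp: J_def layer_def)
  qed
  have h_zero: "h u = 0" if "u \<notin> X" for u
  proof -
    have "h u \<le> 0"
      unfolding h_def using grid_subset[OF f B \<delta>] that
      by (intro SUP_least) (auto simp: indicator_def)
    then show ?thesis by simp
  qed
  have adm: "(\<integral>\<^sup>+u\<in>A. h u \<partial>M) \<le> (\<integral>\<^sup>+u\<in>A. g u \<partial>M)" if A: "A \<in> \<A>" for A
  proof -
    note [measurable] = core_sets[OF A]
    have "(\<integral>\<^sup>+u\<in>A. h u \<partial>M) = (\<integral>\<^sup>+u\<in>(\<Union>j. ?D j). h u * indicator A u \<partial>M)"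
      unfolding layer_Union[OF f B \<delta>] using h_zero
      by (intro nn_integral_cong) (auto split: split_indicator)
    also have "\<dots> \<le> (\<integral>\<^sup>+u\<in>(\<Union>j. ?D j). g u * indicator A u \<partial>M)"
    proof (rule nn_integral_piecewise_le)
      fix j
      have "(\<integral>\<^sup>+u\<in>?D j. h u * indicator A u \<partial>M) = (\<integral>\<^sup>+u. c j * indicator (?D j \<inter> A) u \<partial>M)"
        using h_eq by (intro nn_integral_cong) (auto split: split_indicator)
      also have "\<dots> = c j * emeasure M (?D j \<inter> A)"
        by (rule nn_integral_cmult_indicator) measurable
      also have "\<dots> \<le> (\<integral>\<^sup>+u\<in>?D j \<inter> A. g u \<partial>M)"
        unfolding c_def by (rule mean_down_set_le[OF g core_down_sets[OF A] _ fin]) measurable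
      finally show "(\<integral>\<^sup>+u\<in>?D j. h u * indicator A u \<partial>M) \<le> (\<integral>\<^sup>+u\<in>?D j. g u * indicator A u \<partial>M)"
        by (simp only: indicator_mult_nn_integral)
    qed (use layer_disjoint[OF f B \<delta>] in auto)
    also have "\<dots> \<le> (\<integral>\<^sup>+u\<in>A. g u \<partial>M)"
      by (intro nn_integral_mono) (auto split: split_indicator)
    finally show ?thesis .
  qed
  have "(\<integral>\<^sup>+u. envelope B u * g u \<partial>M) = (\<integral>\<^sup>+u\<in>(\<Union>j. ?D j). envelope B u * g u \<partial>M)"
    unfolding layer_Union[OF f B \<delta>] using envelope_zero[OF B]
    by (intro nn_integral_cong) (auto split: split_indicator)
  also have "\<dots> \<le> (\<integral>\<^sup>+u\<in>(\<Union>j. ?D j). f u * h u + ennreal \<delta> * g u \<partial>M)"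
  proof (rule nn_integral_piecewise_le)
    fix j
    have Suc: "ennreal (real (Suc j) * \<delta>) = ennreal (real j * \<delta>) + ennreal \<delta>"
      using \<delta> by (subst ennreal_plus[symmetric]) (auto simp: pos_rats_def algebra_simps)
    let ?I = "\<integral>\<^sup>+u\<in>?D j. g u \<partial>M"
    have "(\<integral>\<^sup>+u\<in>?D j. envelope B u * g u \<partial>M)
        \<le> (\<integral>\<^sup>+u. ennreal (real (Suc j) * \<delta>) * (g u * indicator (?D j) u) \<partial>M)"
    proof (rule nn_integral_mono)
      fix u
      show "envelope B u * g u * indicator (?D j) u
          \<le> ennreal (real (Suc j) * \<delta>) * (g u * indicator (?D j) u)"
        using envelope_layer_le[OF B \<delta>, of u j]
        by (cases "u \<in> ?D j") (auto intro!: mult_right_mono)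
    qed
    also have "\<dots> = (ennreal (real j * \<delta>) + ennreal \<delta>) * ?I"
      unfolding Suc by (rule nn_integral_cmult) measurable
    also have "\<dots> = c j * (ennreal (real j * \<delta>) * emeasure M (?D j)) + ennreal \<delta> * ?I"
      unfolding c_def using mean_mult[OF layer_sets[OF f B \<delta>, of j] fin, of g]
      by (simp add: distrib_right) (simp add: ac_simps)
    also have "\<dots> \<le> c j * (\<integral>\<^sup>+u\<in>?D j. f u \<partial>M) + ennreal \<delta> * ?I"
      by (intro add_right_mono mult_left_mono layer_lower[OF f B \<delta>]) simp
    also have "\<dots> = (\<integral>\<^sup>+u. c j * (f u * indicator (?D j) u) + ennreal \<delta> * (g u * indicator (?D j) u) \<partial>M)"
      by (subst nn_integral_add, measurable) (simp add: nn_integral_cmult)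
    also have "\<dots> = (\<integral>\<^sup>+u\<in>?D j. f u * h u + ennreal \<delta> * g u \<partial>M)"
      using h_eq by (intro nn_integral_cong) (auto split: split_indicator simp: ac_simps)
    finally show "(\<integral>\<^sup>+u\<in>?D j. envelope B u * g u \<partial>M)
        \<le> (\<integral>\<^sup>+u\<in>?D j. f u * h u + ennreal \<delta> * g u \<partial>M)" .
  qed (use layer_disjoint[OF f B \<delta>] in auto)
  also have "\<dots> \<le> (\<integral>\<^sup>+u. f u * h u + ennreal \<delta> * (g u * indicator X u) \<partial>M)"
    unfolding layer_Union[OF f B \<delta>]
    by (intro nn_integral_mono) (auto split: split_indicator)
  also have "\<dots> = (\<integral>\<^sup>+u. f u * h u \<partial>M) + ennreal \<delta> * (\<integral>\<^sup>+u\<in>X. g u \<partial>M)"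
    by (subst nn_integral_add, measurable) (simp add: nn_integral_cmult)
  finally show ?thesis using h adm by blast
qed

text \<open>
  The supremum in the definition of a level function, for a nonnegative function \<open>f\<close>.
\<close>

definition level_value :: "('a \<Rightarrow> ennreal) \<Rightarrow> ('a \<Rightarrow> ennreal) \<Rightarrow> ennreal" where
  "level_value f g = Sup {(\<integral>\<^sup>+u. f u * h u \<partial>M) | h. h \<in> core_decreasing M \<A> \<and>
     (\<forall>A\<in>\<A>. (\<integral>\<^sup>+u\<in>A. h u \<partial>M) \<le> (\<integral>\<^sup>+u\<in>A. g u \<partial>M))}"

lemma level_value_upper:
  "h \<in> core_decreasing M \<A> \<Longrightarrow> (\<And>A. A \<in> \<A> \<Longrightarrow> (\<integral>\<^sup>+u\<in>A. h u \<partial>M) \<le> (\<integral>\<^sup>+u\<in>A. g u \<partial>M)) \<Longrightarrow>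
    (\<integral>\<^sup>+u. f u * h u \<partial>M) \<le> level_value f g"
  unfolding level_value_def by (rule Sup_upper) blast

lemma level_value_least:
  assumes "\<And>h. h \<in> core_decreasing M \<A> \<Longrightarrow>
    (\<And>A. A \<in> \<A> \<Longrightarrow> (\<integral>\<^sup>+u\<in>A. h u \<partial>M) \<le> (\<integral>\<^sup>+u\<in>A. g u \<partial>M)) \<Longrightarrow> (\<integral>\<^sup>+u. f u * h u \<partial>M) \<le> c"
  shows "level_value f g \<le> c"
  unfolding level_value_def using assms by (intro Sup_least) blast

text \<open>
  For a competitor \<open>h\<close>, passing from \<open>\<integral> f h\<close> to \<open>\<integral> k h\<close>, where \<open>k\<close> is the envelope, uses that \<open>h\<close> is core
  decreasing; passing on to \<open>\<integral> k g\<close> uses that \<open>k\<close> is. The averaged competitors show that nothing is lost.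
\<close>

lemma envelope_level_value:
  assumes f: "tame X f" and B: "level_family X f B" and g: "g \<in> core_decreasing M \<A>"
  shows "(\<integral>\<^sup>+u. envelope B u * g u \<partial>M) = level_value f g"
proof (rule antisym)
  have X: "X \<in> \<A>" using f by (simp add: tame_def)
  have fm: "f \<in> borel_measurable M" using f by (simp add: tame_def)
  note [measurable] = core_sets[OF X] core_decreasing_measurable[OF g]
  have em [measurable]: "envelope B \<in> borel_measurable M"
    using core_decreasing_measurable[OF envelope_core_decreasing[OF B]] .
  show "level_value f g \<le> (\<integral>\<^sup>+u. envelope B u * g u \<partial>M)"
  proof (rule level_value_least)
    fix h assume h: "h \<in> core_decreasing M \<A>"
      and le: "\<And>A. A \<in> \<A> \<Longrightarrow> (\<integral>\<^sup>+u\<in>A. h u \<partial>M) \<le> (\<integral>\<^sup>+u\<in>A. g u \<partial>M)"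
    have "(\<integral>\<^sup>+u. f u * h u \<partial>M) \<le> (\<integral>\<^sup>+u. envelope B u * h u \<partial>M)"
      by (rule core_decreasing_nn_integral_mono[OF fm em h envelope_majorizes[OF f B]])
    also have "\<dots> = (\<integral>\<^sup>+u. h u * envelope B u \<partial>M)" by (simp add: mult.commute)
    also have "\<dots> \<le> (\<integral>\<^sup>+u. g u * envelope B u \<partial>M)"
      by (rule core_decreasing_nn_integral_mono[OF core_decreasing_measurable[OF h]
          core_decreasing_measurable[OF g] envelope_core_decreasing[OF B]
          down_sets_nn_integral_mono[OF h g le]])
    finally show "(\<integral>\<^sup>+u. f u * h u \<partial>M) \<le> (\<integral>\<^sup>+u. envelope B u * g u \<partial>M)"
      by (simp add: mult.commute)
  qed
  \<comment> \<open>The error \<open>\<delta> * (\<integral>\<^sup>+u\<in>X. g u \<partial>M)\<close> vanishes with \<open>\<delta>\<close> only if the integral is finite, hence the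
    truncation of \<open>g\<close>. A competitor for the truncation is one for \<open>g\<close>.\<close>
  have trunc: "(\<integral>\<^sup>+u. envelope B u * min (g u) (of_nat m) \<partial>M) \<le> level_value f g" for m :: nat
  proof (rule ennreal_le_rat_epsilon)
    let ?g = "\<lambda>u. min (g u) (of_nat m)"
    have g': "?g \<in> core_decreasing M \<A>" by (rule core_decreasing_min[OF g])
    have "(\<integral>\<^sup>+u\<in>X. ?g u \<partial>M) \<le> (\<integral>\<^sup>+u. of_nat m * indicator X u \<partial>M)"
      by (intro nn_integral_mono) (auto split: split_indicator)
    also have "\<dots> = of_nat m * emeasure M X" by (rule nn_integral_cmult_indicator) measurable
    also have "\<dots> < \<infinity>"
      using core_finite[OF X] by (simp add: ennreal_mult_less_top of_nat_less_top)
    finally show "(\<integral>\<^sup>+u\<in>X. ?g u \<partial>M) < \<infinity>" .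
    fix \<delta> assume \<delta>: "\<delta> \<in> pos_rats"
    obtain h where h: "h \<in> core_decreasing M \<A>"
        "\<And>A. A \<in> \<A> \<Longrightarrow> (\<integral>\<^sup>+u\<in>A. h u \<partial>M) \<le> (\<integral>\<^sup>+u\<in>A. ?g u \<partial>M)"
        "(\<integral>\<^sup>+u. envelope B u * ?g u \<partial>M) \<le> (\<integral>\<^sup>+u. f u * h u \<partial>M) + ennreal \<delta> * (\<integral>\<^sup>+u\<in>X. ?g u \<partial>M)"
      using envelope_nearly_attained[OF f B g' \<delta>] by blast
    have "(\<integral>\<^sup>+u\<in>A. h u \<partial>M) \<le> (\<integral>\<^sup>+u\<in>A. g u \<partial>M)" if "A \<in> \<A>" for A
      by (rule order_trans[OF h(2)[OF that]]) (auto intro!: nn_integral_mono mult_right_mono)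
    then have "(\<integral>\<^sup>+u. f u * h u \<partial>M) \<le> level_value f g"
      by (rule level_value_upper[OF h(1)])
    then show "(\<integral>\<^sup>+u. envelope B u * ?g u \<partial>M)
        \<le> level_value f g + ennreal \<delta> * (\<integral>\<^sup>+u\<in>X. ?g u \<partial>M)"
      using h(3) by (meson add_right_mono order_trans)
  qed
  have SUP: "(SUP m::nat. min x (of_nat m)) = x" for x :: ennreal
  proof -
    have "(SUP m::nat. min x (of_nat m)) = min x (SUP m::nat. of_nat m)"
      by (simp only: inf_min[symmetric] inf_SUP)
    then show ?thesis by (simp only: ennreal_SUP_of_nat_eq_top) (simp add: min_def)
  qed
  have "(\<integral>\<^sup>+u. envelope B u * g u \<partial>M) = (\<integral>\<^sup>+u. (SUP m::nat. envelope B u * min (g u) (of_nat m)) \<partial>M)"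
    by (simp only: SUP_mult_left_ennreal[symmetric] SUP)
  also have "\<dots> = (SUP m::nat. (\<integral>\<^sup>+u. envelope B u * min (g u) (of_nat m) \<partial>M))"
    by (rule nn_integral_monotone_convergence_SUP)
      (auto simp: incseq_def le_fun_def intro!: mult_left_mono min.mono)
  also have "\<dots> \<le> level_value f g" using trunc by (intro SUP_least)
  finally show "(\<integral>\<^sup>+u. envelope B u * g u \<partial>M) \<le> level_value f g" .
qed

section \<open>Uniqueness of integrable level functions\<close>

text \<open>
  The set where \<open>k > t > s \<ge> k'\<close> is empty or a difference of two nested down-sets. On the latter both
  functions have the same finite integral, so it is null.
\<close>

lemma core_decreasing_le_AE:
  assumes k: "k \<in> core_decreasing M \<A>" and k': "k' \<in> core_decreasing M \<A>"
    and eq: "\<And>B. B \<in> down_sets \<Longrightarrow> (\<integral>\<^sup>+u\<in>B. k u \<partial>M) = (\<integral>\<^sup>+u\<in>B. k' u \<partial>M)"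
    and fin: "(\<integral>\<^sup>+u. k u \<partial>M) < \<infinity>"
  shows "AE u in M. k u \<le> k' u"
proof -
  note [measurable] = core_decreasing_measurable[OF k] core_decreasing_measurable[OF k']
  have "AE u in M. ennreal t < k u \<longrightarrow> ennreal s < k' u"
    if st: "s \<in> pos_rats" "t \<in> pos_rats" "s < t" for s t
  proof -
    define B where "B = {u \<in> space M. ennreal t < k u}"
    define B' where "B' = {u \<in> space M. ennreal s < k' u}"
    have d: "B \<in> down_sets" "B' \<in> down_sets"
      unfolding B_def B'_def using superlevel_down_sets k k' by auto
    note [measurable] = down_sets_sets[OF d(1)] down_sets_sets[OF d(2)]
    have "emeasure M (B - B') = 0"
    proof (cases "B \<subseteq> B'")
      case True
      then have "B - B' = {}" by blast
      then show ?thesis by (simp only: emeasure_empty)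
    next
      case False
      then have "B' \<subseteq> B" using down_sets_chain[OF d] by blast
      then have "B = B' \<union> (B - B')" by blast
      then have split: "(\<integral>\<^sup>+u\<in>B. \<rho> u \<partial>M) = (\<integral>\<^sup>+u\<in>B'. \<rho> u \<partial>M) + (\<integral>\<^sup>+u\<in>B - B'. \<rho> u \<partial>M)"
        if "\<rho> \<in> borel_measurable M" for \<rho>
        using nn_integral_split[OF that, of B' "B - B'"] by simp
      have sub: "(\<integral>\<^sup>+u\<in>D. k u \<partial>M) < \<infinity>" for D
        by (rule le_less_trans[OF nn_integral_mono fin]) (auto split: split_indicator)
      have "(\<integral>\<^sup>+u\<in>B'. k u \<partial>M) + (\<integral>\<^sup>+u\<in>B - B'. k u \<partial>M) \<le> (\<integral>\<^sup>+u\<in>B'. k u \<partial>M) + (\<integral>\<^sup>+u\<in>B - B'. k' u \<partial>M)"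
        using eq[OF d(1)] eq[OF d(2)] split[OF core_decreasing_measurable[OF k]]
          split[OF core_decreasing_measurable[OF k']] by (metis order_refl)
      then have kk': "(\<integral>\<^sup>+u\<in>B - B'. k u \<partial>M) \<le> (\<integral>\<^sup>+u\<in>B - B'. k' u \<partial>M)"
        using sub by (rule ennreal_add_le_cancel_left)
      have "ennreal t * emeasure M (B - B') = (\<integral>\<^sup>+u. ennreal t * indicator (B - B') u \<partial>M)"
        by (simp add: nn_integral_cmult_indicator)
      also have "\<dots> \<le> (\<integral>\<^sup>+u\<in>B - B'. k u \<partial>M)"
        by (intro nn_integral_mono) (auto split: split_indicator simp: B_def less_imp_le)
      finally have t: "ennreal t * emeasure M (B - B') \<le> (\<integral>\<^sup>+u\<in>B - B'. k u \<partial>M)" .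
      note kk'
      also have "(\<integral>\<^sup>+u\<in>B - B'. k' u \<partial>M) \<le> (\<integral>\<^sup>+u. ennreal s * indicator (B - B') u \<partial>M)"
        by (intro nn_integral_mono) (auto split: split_indicator simp: B_def B'_def not_less)
      also have "\<dots> = ennreal s * emeasure M (B - B')"
        by (simp add: nn_integral_cmult_indicator)
      finally have s: "(\<integral>\<^sup>+u\<in>B - B'. k u \<partial>M) \<le> ennreal s * emeasure M (B - B')" .
      have "ennreal t * emeasure M (B - B') < \<infinity>" using t sub by (rule le_less_trans)
      then show ?thesis
        using order_trans[OF t s] st
        by (cases "emeasure M (B - B')")
          (auto simp: ennreal_mult[symmetric] pos_rats_def ennreal_mult_top mult_le_cancel_right)
    qed
    then have "AE u in M. u \<notin> B - B'" by (intro AE_not_in null_setsI) auto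
    then show ?thesis by (rule AE_mp) (auto simp: B_def B'_def)
  qed
  then have "AE u in M. \<forall>s\<in>pos_rats. \<forall>t\<in>pos_rats. s < t \<longrightarrow> ennreal t < k u \<longrightarrow> ennreal s < k' u"
    by (simp add: AE_ball_countable[OF countable_pos_rats])
  then show ?thesis
  proof (rule eventually_mono)
    fix u assume u: "\<forall>s\<in>pos_rats. \<forall>t\<in>pos_rats. s < t \<longrightarrow> ennreal t < k u \<longrightarrow> ennreal s < k' u"
    show "k u \<le> k' u"
    proof (rule ccontr)
      assume "\<not> k u \<le> k' u"
      then obtain s where s: "s \<in> pos_rats" "k' u < ennreal s" "ennreal s < k u"
        by (meson not_le pos_rats_dense)
      then obtain t where t: "t \<in> pos_rats" "ennreal s < ennreal t" "ennreal t < k u"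
        by (meson pos_rats_dense)
      have "s < t" using t(2) by (metis ennreal_leI not_le)
      then have "ennreal s < k' u" using u s(1) t by blast
      then show False using s(2) by simp
    qed
  qed
qed

text \<open>
  Indicators of down-sets as test functions determine the integrals of a level function over all
  down-sets, which include its superlevel sets. For general \<open>f\<close> these integrals can be infinite and
  uniqueness can fail.
\<close>

lemma tame_level_function_unique:
  assumes f: "tame X f"
    and k: "k \<in> core_decreasing M \<A>" "\<And>g. g \<in> core_decreasing M \<A> \<Longrightarrow> (\<integral>\<^sup>+u. k u * g u \<partial>M) = level_value f g"
    and k': "k' \<in> core_decreasing M \<A>" "\<And>g. g \<in> core_decreasing M \<A> \<Longrightarrow> (\<integral>\<^sup>+u. k' u * g u \<partial>M) = level_value f g"
  shows "AE u in M. k u = k' u"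
proof -
  \<comment> \<open>The constant one as a test function shows that all level functions of \<open>f\<close> are integrable.\<close>
  have one: "(\<lambda>u. 1 * indicator (space M) u) \<in> core_decreasing M \<A>"
    by (rule indicator_core_decreasing[OF space_down_sets])
  have fin: "level_value f (\<lambda>u. 1 * indicator (space M) u) < \<infinity>"
  proof -
    obtain C where C: "\<And>u. f u \<le> ennreal C * indicator X u" using f by (auto simp: tame_def)
    have X: "X \<in> \<A>" using f by (simp add: tame_def)
    note [measurable] = core_sets[OF X]
    have "level_value f (\<lambda>u. 1 * indicator (space M) u) \<le> ennreal C * emeasure M X"
    proof (rule level_value_least)
      fix h assume h: "h \<in> core_decreasing M \<A>" and
        le: "\<And>A. A \<in> \<A> \<Longrightarrow> (\<integral>\<^sup>+u\<in>A. h u \<partial>M) \<le> (\<integral>\<^sup>+u\<in>A. 1 * indicator (space M) u \<partial>M)"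
      note [measurable] = core_decreasing_measurable[OF h]
      have "(\<integral>\<^sup>+u. f u * h u \<partial>M) \<le> (\<integral>\<^sup>+u. ennreal C * (h u * indicator X u) \<partial>M)"
        using C by (intro nn_integral_mono) (metis mult.assoc mult.commute mult_right_mono zero_le)
      also have "\<dots> = ennreal C * (\<integral>\<^sup>+u\<in>X. h u \<partial>M)" by (rule nn_integral_cmult) measurable
      also have "\<dots> \<le> ennreal C * (\<integral>\<^sup>+u\<in>X. 1 * indicator (space M) u \<partial>M)"
        by (intro mult_left_mono le X) simp
      also have "(\<integral>\<^sup>+u\<in>X. 1 * indicator (space M) u \<partial>M) = (\<integral>\<^sup>+u. indicator X u \<partial>M)"
        by (intro nn_integral_cong) (auto split: split_indicator)
      finally show "(\<integral>\<^sup>+u. f u * h u \<partial>M) \<le> ennreal C * emeasure M X" by simp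
    qed
    also have "\<dots> < \<infinity>" using core_finite[OF X] by (simp add: ennreal_mult_less_top)
    finally show ?thesis .
  qed
  have total: "(\<integral>\<^sup>+u. \<kappa> u \<partial>M) < \<infinity>"
    if "\<And>g. g \<in> core_decreasing M \<A> \<Longrightarrow> (\<integral>\<^sup>+u. \<kappa> u * g u \<partial>M) = level_value f g" for \<kappa>
  proof -
    have "(\<integral>\<^sup>+u. \<kappa> u \<partial>M) = (\<integral>\<^sup>+u. \<kappa> u * (1 * indicator (space M) u) \<partial>M)"
      by (intro nn_integral_cong) simp
    then show ?thesis using that[OF one] fin by simp
  qed
  have eq: "(\<integral>\<^sup>+u\<in>B. k u \<partial>M) = (\<integral>\<^sup>+u\<in>B. k' u \<partial>M)" if "B \<in> down_sets" for B
    using k(2)[OF indicator_core_decreasing[OF that, of 1]]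
      k'(2)[OF indicator_core_decreasing[OF that, of 1]] by simp
  have "AE u in M. k u \<le> k' u" "AE u in M. k' u \<le> k u"
    using core_decreasing_le_AE[OF k(1) k'(1) eq total[OF k(2)]]
      core_decreasing_le_AE[OF k'(1) k(1) eq[symmetric] total[OF k'(2)]] by auto
  then show ?thesis by eventually_elim simp
qed

section \<open>The level map\<close>

text \<open>
  Two suprema are interchanged, one of them given by monotone convergence for each competitor.
\<close>

lemma level_value_SUP_AE:
  fixes f :: "nat \<Rightarrow> 'a \<Rightarrow> ennreal"
  assumes [measurable]: "\<And>n. f n \<in> borel_measurable M"
    and mono: "\<And>n. AE u in M. f n u \<le> f (Suc n) u" and SUP: "AE u in M. F u = (SUP n. f n u)"
  shows "level_value F g = (SUP n. level_value (f n) g)"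
proof (rule antisym)
  have eq: "(\<integral>\<^sup>+u. F u * h u \<partial>M) = (SUP n. (\<integral>\<^sup>+u. f n u * h u \<partial>M))"
    if "h \<in> core_decreasing M \<A>" for h
    using core_decreasing_measurable[OF that] by (intro nn_integral_mult_SUP_AE mono SUP) auto
  show "level_value F g \<le> (SUP n. level_value (f n) g)"
    by (intro level_value_least) (simp only: eq, intro SUP_mono' level_value_upper)
  show "(SUP n. level_value (f n) g) \<le> level_value F g"
  proof (intro SUP_least level_value_least)
    fix n h assume h: "h \<in> core_decreasing M \<A>"
      "\<And>A. A \<in> \<A> \<Longrightarrow> (\<integral>\<^sup>+u\<in>A. h u \<partial>M) \<le> (\<integral>\<^sup>+u\<in>A. g u \<partial>M)"
    have "(\<integral>\<^sup>+u. f n u * h u \<partial>M) \<le> (\<integral>\<^sup>+u. F u * h u \<partial>M)"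
      unfolding eq[OF h(1)] by (rule SUP_upper) simp
    also have "\<dots> \<le> level_value F g" by (rule level_value_upper[OF h])
    finally show "(\<integral>\<^sup>+u. f n u * h u \<partial>M) \<le> level_value F g" .
  qed
qed

definition exhaustion :: "nat \<Rightarrow> 'a set" where
  "exhaustion = (SOME X. range X \<subseteq> \<A> \<and> incseq X \<and> (\<Union>n. X n) = space M)"

lemma exhaustion_core: "exhaustion n \<in> \<A>"
  and exhaustion_incseq: "incseq exhaustion"
  and exhaustion_Union: "(\<Union>n. exhaustion n) = space M"
proof -
  have "\<exists>X. range X \<subseteq> \<A> \<and> incseq X \<and> (\<Union>n::nat. X n) = space M"
    by (rule core_exhaustion) blast
  then have "range exhaustion \<subseteq> \<A> \<and> incseq exhaustion \<and> (\<Union>n. exhaustion n) = space M"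
    unfolding exhaustion_def by (rule someI_ex)
  then show "exhaustion n \<in> \<A>" "incseq exhaustion" "(\<Union>n. exhaustion n) = space M" by auto
qed

definition truncation :: "nat \<Rightarrow> ('a \<Rightarrow> ennreal) \<Rightarrow> 'a \<Rightarrow> ennreal" where
  "truncation n f u = min (f u) (of_nat n) * indicator (exhaustion n) u"

text \<open>
  The choice of the family affects the function only on a null set, by monotonicity.
\<close>

definition truncated_level :: "nat \<Rightarrow> ('a \<Rightarrow> ennreal) \<Rightarrow> 'a \<Rightarrow> ennreal" where
  "truncated_level n f = envelope (SOME B. level_family (exhaustion n) (truncation n f) B)"

definition level_map :: "('a \<Rightarrow> ennreal) \<Rightarrow> 'a \<Rightarrow> ennreal" where
  "level_map f u = (SUP n. truncated_level n f u)"

lemma truncation_mono: "f u \<le> f' u \<Longrightarrow> m \<le> n \<Longrightarrow> truncation m f u \<le> truncation n f' u"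
  using incseqD[OF exhaustion_incseq, of m n]
  unfolding truncation_def by (intro mult_mono min.mono) (auto split: split_indicator)

lemma truncation_SUP:
  assumes "u \<in> space M"
  shows "(SUP n. truncation n f u) = f u"
proof (rule antisym)
  show "(SUP n. truncation n f u) \<le> f u"
    by (rule SUP_least) (auto simp: truncation_def split: split_indicator)
  obtain m where m: "u \<in> exhaustion m" using assms exhaustion_Union by blast
  have "min (f u) (of_nat n) \<le> truncation (max m n) f u" for n
  proof -
    have "u \<in> exhaustion (max m n)" using m incseqD[OF exhaustion_incseq, of m "max m n"] by auto
    then have "truncation (max m n) f u = min (f u) (of_nat (max m n))" by (simp add: truncation_def)
    moreover have "min (f u) (of_nat n) \<le> min (f u) (of_nat (max m n))"
      by (intro min.mono order_refl) (simp add: of_nat_mono)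
    ultimately show ?thesis by (simp only:)
  qed
  then have "(SUP n. min (f u) (of_nat n)) \<le> (SUP n. truncation n f u)"
    by (intro SUP_least) (blast intro: SUP_upper2)
  also have "(SUP n. min (f u) (of_nat n)) = min (f u) (SUP n. of_nat n)"
    by (simp only: inf_min[symmetric] inf_SUP)
  also have "\<dots> = f u" by (simp only: ennreal_SUP_of_nat_eq_top) (simp add: min_def)
  finally show "f u \<le> (SUP n. truncation n f u)" .
qed

context
  fixes f :: "'a \<Rightarrow> ennreal"
  assumes f [measurable]: "f \<in> borel_measurable M"
begin

lemma truncation_measurable [measurable]: "truncation n f \<in> borel_measurable M"
proof -
  note [measurable] = core_sets[OF exhaustion_core[of n]]
  show ?thesis unfolding truncation_def[abs_def] by measurable
qed

lemma truncation_tame: "tame (exhaustion n) (truncation n f)"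
  unfolding tame_def
proof (intro conjI exhaustion_core truncation_measurable exI[of _ "real n"] allI)
  show "truncation n f u \<le> ennreal (real n) * indicator (exhaustion n) u" for u
    by (auto simp: truncation_def ennreal_of_nat_eq_real_of_nat intro!: mult_right_mono)
qed

lemma truncated_level_family:
  "level_family (exhaustion n) (truncation n f)
     (SOME B. level_family (exhaustion n) (truncation n f) B)"
  by (rule someI_ex[OF level_family_exists[OF truncation_tame]])

lemma truncated_level_core_decreasing: "truncated_level n f \<in> core_decreasing M \<A>"
  unfolding truncated_level_def by (rule envelope_core_decreasing[OF truncated_level_family])

lemma truncated_level_value:
  "g \<in> core_decreasing M \<A> \<Longrightarrow>
    (\<integral>\<^sup>+u. truncated_level n f u * g u \<partial>M) = level_value (truncation n f) g"
  unfolding truncated_level_def by (rule envelope_level_value[OF truncation_tame truncated_level_family])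

lemma level_map_core_decreasing: "level_map f \<in> core_decreasing M \<A>"
  unfolding level_map_def[abs_def] using truncated_level_core_decreasing
  by (intro core_decreasing_SUP) auto

end

lemma truncated_level_mono:
  assumes f: "f \<in> borel_measurable M" "f' \<in> borel_measurable M"
    and le: "AE u in M. f u \<le> f' u" and mn: "m \<le> n"
  shows "AE u in M. truncated_level m f u \<le> truncated_level n f' u"
  unfolding truncated_level_def
proof (rule envelope_mono[OF truncation_tame[OF f(1)] truncation_tame[OF f(2)] _ _
      truncated_level_family[OF f(1)] truncated_level_family[OF f(2)]])
  show "exhaustion m \<subseteq> exhaustion n" using incseqD[OF exhaustion_incseq mn] .
  show "AE u in M. truncation m f u \<le> truncation n f' u"
    using le by eventually_elim (rule truncation_mono[OF _ mn])
qed

lemma level_map_value: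
  assumes f: "f \<in> borel_measurable M" and g: "g \<in> core_decreasing M \<A>"
  shows "(\<integral>\<^sup>+u. level_map f u * g u \<partial>M) = level_value f g"
proof -
  have "(\<integral>\<^sup>+u. level_map f u * g u \<partial>M) = (SUP n. (\<integral>\<^sup>+u. truncated_level n f u * g u \<partial>M))"
    using core_decreasing_measurable[OF g]
      core_decreasing_measurable[OF truncated_level_core_decreasing[OF f]]
      truncated_level_mono[OF f f]
    by (intro nn_integral_mult_SUP_AE) (auto simp: level_map_def)
  also have "\<dots> = (SUP n. level_value (truncation n f) g)"
    by (simp add: truncated_level_value[OF f g])
  also have "\<dots> = level_value f g"
    using truncation_measurable[OF f]
    by (intro level_value_SUP_AE[symmetric] AE_I2) (auto simp: truncation_SUP intro: truncation_mono)
  finally show ?thesis .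
qed

lemma level_map_mono:
  assumes f: "f \<in> borel_measurable M" "f' \<in> borel_measurable M" and le: "AE u in M. f u \<le> f' u"
  shows "AE u in M. level_map f u \<le> level_map f' u"
proof -
  have "AE u in M. \<forall>n. truncated_level n f u \<le> truncated_level n f' u"
    using truncated_level_mono[OF f le] by (simp add: AE_all_countable)
  then show ?thesis
    by eventually_elim (auto simp: level_map_def intro: SUP_mono')
qed

text \<open>
  The supremum on the right is again a level function of the truncation of \<open>F\<close>, and the level
  function of a tame function is unique.
\<close>

lemma truncated_level_SUP:
  fixes f :: "nat \<Rightarrow> 'a \<Rightarrow> ennreal"
  assumes f: "\<And>n. f n \<in> borel_measurable M" and F: "F \<in> borel_measurable M"
    and mono: "\<And>n. AE u in M. f n u \<le> f (Suc n) u" and SUP: "AE u in M. F u = (SUP n. f n u)"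
  shows "AE u in M. truncated_level m F u = (SUP n. truncated_level m (f n) u)"
proof (rule tame_level_function_unique[OF truncation_tame[OF F]])
  show "truncated_level m F \<in> core_decreasing M \<A>" by (rule truncated_level_core_decreasing[OF F])
  show "(\<lambda>u. SUP n. truncated_level m (f n) u) \<in> core_decreasing M \<A>"
    using truncated_level_core_decreasing[OF f] by (intro core_decreasing_SUP) auto
  fix g assume g: "g \<in> core_decreasing M \<A>"
  show "(\<integral>\<^sup>+u. truncated_level m F u * g u \<partial>M) = level_value (truncation m F) g"
    by (rule truncated_level_value[OF F g])
  have "(\<integral>\<^sup>+u. (SUP n. truncated_level m (f n) u) * g u \<partial>M)
      = (SUP n. (\<integral>\<^sup>+u. truncated_level m (f n) u * g u \<partial>M))"
    using core_decreasing_measurable[OF g]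
      core_decreasing_measurable[OF truncated_level_core_decreasing[OF f]]
      truncated_level_mono[OF f f mono]
    by (intro nn_integral_mult_SUP_AE) auto
  also have "\<dots> = (SUP n. level_value (truncation m (f n)) g)"
    by (simp add: truncated_level_value[OF f g])
  also have "\<dots> = level_value (truncation m F) g"
  proof (rule level_value_SUP_AE[symmetric])
    show "truncation m (f n) \<in> borel_measurable M" for n by (rule truncation_measurable[OF f])
    show "AE u in M. truncation m (f n) u \<le> truncation m (f (Suc n)) u" for n
      using mono[of n] by eventually_elim (simp add: truncation_mono)
    show "AE u in M. truncation m F u = (SUP n. truncation m (f n) u)"
      using SUP
    proof eventually_elim
      case (elim u)
      have "min (SUP n. f n u) (of_nat m) = (SUP n. min (f n u) (of_nat m))"
        by (simp only: inf_min[symmetric] SUP_inf)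
      with elim show ?case by (simp add: truncation_def SUP_mult_right_ennreal)
    qed
  qed
  finally show "(\<integral>\<^sup>+u. (SUP n. truncated_level m (f n) u) * g u \<partial>M) = level_value (truncation m F) g" .
qed

text \<open>
  Both sides are double suprema over truncations and over the sequence.
\<close>

lemma level_map_SUP:
  fixes f :: "nat \<Rightarrow> 'a \<Rightarrow> ennreal"
  assumes f: "\<And>n. f n \<in> borel_measurable M" and F: "F \<in> borel_measurable M"
    and mono: "\<And>n. AE u in M. f n u \<le> f (Suc n) u" and SUP: "AE u in M. F u = (SUP n. f n u)"
  shows "AE u in M. level_map F u = (SUP n. level_map (f n) u)"
proof -
  have "AE u in M. \<forall>m. truncated_level m F u = (SUP n. truncated_level m (f n) u)"
    using truncated_level_SUP[OF assms] by (simp add: AE_all_countable)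
  then show ?thesis
  proof eventually_elim
    case (elim u)
    then have "level_map F u = (SUP m. SUP n. truncated_level m (f n) u)" by (simp add: level_map_def)
    also have "\<dots> = (SUP n. SUP m. truncated_level m (f n) u)" by (rule SUP_commute)
    finally show ?case by (simp add: level_map_def)
  qed
qed

lemma level_function_iff:
  "level_function M \<A> f k \<longleftrightarrow> k \<in> core_decreasing M \<A> \<and>
     (\<forall>g\<in>core_decreasing M \<A>. (\<integral>\<^sup>+u. k u * g u \<partial>M) = level_value (\<lambda>u. e2ennreal \<bar>f u\<bar>) g)"
  unfolding level_function_def level_value_def by simp

lemma monotone_level_map_level_map:
  "monotone_level_map M \<A> (\<lambda>f. level_map (\<lambda>u. e2ennreal \<bar>f u\<bar>))"
  unfolding monotone_level_map_def
proof (intro conjI ballI allI impI)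
  show "(\<lambda>f. level_map (\<lambda>u. e2ennreal \<bar>f u\<bar>)) \<in> borel_measurable M \<rightarrow> core_decreasing M \<A>"
    by (auto intro!: level_map_core_decreasing)
  show "level_function M \<A> f (level_map (\<lambda>u. e2ennreal \<bar>f u\<bar>))"
    if [measurable]: "f \<in> borel_measurable M" for f :: "'a \<Rightarrow> ereal"
    unfolding level_function_iff by (intro conjI ballI level_map_core_decreasing level_map_value) auto
  fix fs :: "nat \<Rightarrow> 'a \<Rightarrow> ereal" and f
  assume fs: "\<forall>n. fs n \<in> borel_measurable M" and f [measurable]: "f \<in> borel_measurable M"
    and conv: "AE u in M. (\<forall>n. 0 \<le> fs n u) \<and> incseq (\<lambda>n. fs n u) \<and> (\<lambda>n. fs n u) \<longlonglongrightarrow> f u"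
  have [measurable]: "fs n \<in> borel_measurable M" for n using fs by simp
  let ?fs = "\<lambda>n u. e2ennreal \<bar>fs n u\<bar>" and ?f = "\<lambda>u. e2ennreal \<bar>f u\<bar>"
  have inc: "AE u in M. incseq (\<lambda>n. ?fs n u) \<and> ?f u = (SUP n. ?fs n u)"
    using conv
  proof eventually_elim
    case (elim u)
    then have abs: "\<bar>fs n u\<bar> = fs n u" for n by simp
    have "0 \<le> f u" using elim by (auto intro: LIMSEQ_le_const)
    then have absf: "\<bar>f u\<bar> = f u" by simp
    have i: "incseq (\<lambda>n. e2ennreal (fs n u))"
      using elim by (auto simp: incseq_def intro: e2ennreal_mono)
    moreover have "(\<lambda>n. e2ennreal (fs n u)) \<longlonglongrightarrow> e2ennreal (f u)"
      using elim by (intro tendsto_e2ennrealI) auto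
    ultimately have "(SUP n. e2ennreal (fs n u)) = e2ennreal (f u)" by (rule SUP_Lim)
    with i show ?case by (simp add: abs absf)
  qed
  have mono: "AE u in M. ?fs n u \<le> ?fs (Suc n) u" for n
    using inc
  proof eventually_elim
    case (elim u)
    then show ?case using incseqD[of "\<lambda>n. ?fs n u" n "Suc n"] by simp
  qed
  have "AE u in M. \<forall>n. level_map (?fs n) u \<le> level_map (?fs (Suc n)) u"
    unfolding AE_all_countable by (intro allI level_map_mono mono) measurable
  moreover have "AE u in M. level_map ?f u = (SUP n. level_map (?fs n) u)"
    using inc by (intro level_map_SUP mono) auto
  ultimately show "AE u in M. incseq (\<lambda>n. level_map (?fs n) u) \<and>
      (\<lambda>n. level_map (?fs n) u) \<longlonglongrightarrow> level_map ?f u"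
  proof eventually_elim
    case (elim u)
    then have "incseq (\<lambda>n. level_map (?fs n) u)" by (intro incseq_SucI) auto
    with elim show ?case using LIMSEQ_SUP by auto
  qed
qed

text \<open>
  The truncations of \<open>f\<close> are tame, so any two such maps agree on them, and \<open>f\<close> is their increasing
  limit.
\<close>

lemma monotone_level_map_unique:
  assumes L: "monotone_level_map M \<A> L" and L': "monotone_level_map M \<A> L'"
    and f [measurable]: "f \<in> borel_measurable M" and pos: "AE u in M. 0 \<le> f u"
  shows "AE u in M. L' f u = L f u"
proof -
  define \<phi> where "\<phi> u = e2ennreal (f u)" for u
  have \<phi> [measurable]: "\<phi> \<in> borel_measurable M" unfolding \<phi>_def[abs_def] by measurable
  define fs where "fs n u = enn2ereal (truncation n \<phi> u)" for n u
  have fs [measurable]: "fs n \<in> borel_measurable M" for n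
    unfolding fs_def[abs_def] using truncation_measurable[OF \<phi>] by measurable
  have abs: "(\<lambda>u. e2ennreal \<bar>fs n u\<bar>) = truncation n \<phi>" for n by (simp add: fs_def)
  have conv: "AE u in M. (\<forall>n. 0 \<le> fs n u) \<and> incseq (\<lambda>n. fs n u) \<and> (\<lambda>n. fs n u) \<longlonglongrightarrow> f u"
    using pos AE_space
  proof eventually_elim
    case (elim u)
    have i: "incseq (\<lambda>n. truncation n \<phi> u)" by (auto simp: incseq_def intro: truncation_mono)
    then have "(\<lambda>n. truncation n \<phi> u) \<longlonglongrightarrow> \<phi> u"
      using LIMSEQ_SUP[OF i] truncation_SUP[OF elim(2)] by simp
    then have "(\<lambda>n. fs n u) \<longlonglongrightarrow> enn2ereal (\<phi> u)"
      unfolding fs_def by (rule tendsto_enn2erealI)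
    moreover have "enn2ereal (\<phi> u) = f u" using elim(1) by (simp add: \<phi>_def enn2ereal_e2ennreal)
    moreover have "incseq (\<lambda>n. fs n u)"
      using i unfolding incseq_def fs_def by (simp add: less_eq_ennreal.rep_eq)
    ultimately show ?case by (simp add: fs_def)
  qed
  have lim: "AE u in M. (\<lambda>n. K (fs n) u) \<longlonglongrightarrow> K f u" if "monotone_level_map M \<A> K" for K
    using that[unfolded monotone_level_map_def, THEN conjunct2, THEN conjunct2, rule_format,
        OF fs f conv]
    by eventually_elim (rule conjunct2)
  have lev: "K (fs n) \<in> core_decreasing M \<A>"
      "\<And>g. g \<in> core_decreasing M \<A> \<Longrightarrow> (\<integral>\<^sup>+u. K (fs n) u * g u \<partial>M) = level_value (truncation n \<phi>) g"
    if "monotone_level_map M \<A> K" for K n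
  proof -
    have "level_function M \<A> (fs n) (K (fs n))"
      using that fs unfolding monotone_level_map_def by blast
    then show "K (fs n) \<in> core_decreasing M \<A>"
      "\<And>g. g \<in> core_decreasing M \<A> \<Longrightarrow> (\<integral>\<^sup>+u. K (fs n) u * g u \<partial>M) = level_value (truncation n \<phi>) g"
      unfolding level_function_iff abs by blast+
  qed
  have "AE u in M. \<forall>n. L' (fs n) u = L (fs n) u"
    unfolding AE_all_countable
    by (intro allI tame_level_function_unique[OF truncation_tame[OF \<phi>] lev[OF L'] lev[OF L]])
  with lim[OF L] lim[OF L'] show ?thesis
    by eventually_elim (simp add: LIMSEQ_unique)
qed

end

section \<open>Existence and uniqueness\<close>

theorem lemma7p5:
  fixes M :: "'a measure" and \<A> :: "'a set set"
  assumes "sigma_finite_measure M" and "full_ordered_core M \<A>"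
  shows "\<exists>L. monotone_level_map M \<A> L \<and> abs_invariant M L \<and>
    (\<forall>L'. monotone_level_map M \<A> L' \<longrightarrow>
       (\<forall>f\<in>borel_measurable M. (AE u in M. 0 \<le> f u) \<longrightarrow> (AE u in M. L' f u = L f u)) \<and>
       (abs_invariant M L' \<longrightarrow>
          (\<forall>f\<in>borel_measurable M. AE u in M. L' f u = L f u)))"
proof -
  interpret full_core M \<A>
    using assms by (simp add: full_core_def full_core_axioms_def)
  let ?L = "\<lambda>f :: 'a \<Rightarrow> ereal. level_map (\<lambda>u. e2ennreal \<bar>f u\<bar>)"
  show ?thesis
  proof (intro exI[of _ ?L] conjI allI impI ballI)
    show L: "monotone_level_map M \<A> ?L" by (rule monotone_level_map_level_map)
    show "abs_invariant M ?L" by (simp add: abs_invariant_def)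
    fix L' assume L': "monotone_level_map M \<A> L'"
    show pos: "AE u in M. L' f u = ?L f u"
      if "f \<in> borel_measurable M" "AE u in M. 0 \<le> f u" for f
      by (rule monotone_level_map_unique[OF L L' that])
    show "AE u in M. L' f u = ?L f u"
      if "abs_invariant M L'" and f [measurable]: "f \<in> borel_measurable M" for f
    proof -
      have "AE u in M. L' f u = L' (\<lambda>v. \<bar>f v\<bar>) u"
        using that by (simp add: abs_invariant_def)
      moreover have "AE u in M. L' (\<lambda>v. \<bar>f v\<bar>) u = ?L (\<lambda>v. \<bar>f v\<bar>) u"
        by (rule pos) auto
      ultimately show ?thesis by eventually_elim simp
    qed
  qed
qed

end
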